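(* There is an open set $\mathcal{P}\subset\mathbb{C}^4$ containing $(0,0,0,0)$ and each of the parameters $(A(a),B(a),C(a),D(a))$, $a\in(-2,2)$, where $A(a)=B(a)=C(a)=2a+4$ and $D(a)=-(a^2+8a+8)$, with the following property. For any $(A,B,C,D)\in\mathcal{P}$ there are disjoint non-empty open sets $U,V_{\rm BQ}\subset S_{A,B,C,D}$ such that: (1) the action of $\mathcal{G}_{A,B,C,D}$ is locally non-discrete on $U$; i.e. $U\subset\mathcal{N}_{A,B,C,D}$; (2) the action of $\mathcal{G}_{A,B,C,D}$ is locally discrete on any open neighborhood of any point of $V_{\rm BQ}$, i.e. $V_{\rm BQ}\subset\mathcal{D}_{A,B,C,D}$; indeed, the action of $\mathcal{G}_{A,B,C,D}$ on $V_{\rm BQ}$ is properly discontinuous. Moreover, there are non-commuting pairs of elements of $\mathcal{G}_{A,B,C,D}$ both of which are arbitrarily close to the identity on $U$: for every $\delta>0$ there exist $\gamma_1,\gamma_2\in\mathcal{G}_{A,B,C,D}$ with $\gamma_1\gamma_2\neq\gamma_2\gamma_1$ and $\sup_{q\in U}\|\gamma_i(q)-q\|<\delta$ for $i=1,2$.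
   Context: For $(A,B,C,D)\in\mathbb{C}^4$ let $S_{A,B,C,D}=\{(x,y,z)\in\mathbb{C}^3: x^2+y^2+z^2+xyz=Ax+By+Cz+D\}$. The involutions $s_x(x,y,z)=(-x-yz+A,\,y,\,z)$, $s_y(x,y,z)=(x,\,-y-xz+B,\,z)$, $s_z(x,y,z)=(x,\,y,\,-z-xy+C)$ preserve $S_{A,B,C,D}$. Let $\mathcal{G}_{A,B,C,D}=\langle g_x,g_y,g_z\rangle$ be the group of automorphisms of $S_{A,B,C,D}$ generated by $g_x=s_z\circ s_y$, $g_y=s_x\circ s_z$, $g_z=s_y\circ s_x$. The group $\mathcal{G}_{A,B,C,D}$ is locally non-discrete on an open set $U\subset S_{A,B,C,D}$ if there is a sequence $f_n\in\mathcal{G}_{A,B,C,D}\setminus\{\mathrm{id}\}$ converging uniformly to the identity on compact subsets of $U$; otherwise it is locally discrete on $U$. $\mathcal{N}_{A,B,C,D}$ is the set of $p\in S_{A,B,C,D}$ having an open neighborhood on which $\mathcal{G}_{A,B,C,D}$ is locally non-discrete, and $\mathcal{D}_{A,B,C,D}=S_{A,B,C,D}\setminus\mathcal{N}_{A,B,C,D}$. The action on an open set $V$ is properly discontinuous if for every compact $K\subset V$ only finitely many $\gamma\in\mathcal{G}_{A,B,C,D}$ satisfy $\gamma(K)\cap K\neq\emptyset$. $\|\cdot\|$ is the Euclidean norm of $\mathbb{C}^3$. *)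

theory Defs
  imports "HOL-Analysis.Analysis" "HOL-Algebra.Bij" "HOL-Algebra.Generated_Groups"
begin

(* On this product type norm, dist and the topology are the Euclidean ones of C^3. *)
type_synonym complex3 = "complex \<times> complex \<times> complex"

definition surface :: "complex \<Rightarrow> complex \<Rightarrow> complex \<Rightarrow> complex \<Rightarrow> complex3 set" where
  "surface A B C D =
     {(x, y, z). x\<^sup>2 + y\<^sup>2 + z\<^sup>2 + x * y * z = A * x + B * y + C * z + D}"

definition s_x :: "complex \<Rightarrow> complex3 \<Rightarrow> complex3" where
  "s_x A = (\<lambda>(x, y, z). (- x - y * z + A, y, z))"

definition s_y :: "complex \<Rightarrow> complex3 \<Rightarrow> complex3" where
  "s_y B = (\<lambda>(x, y, z). (x, - y - x * z + B, z))"

definition s_z :: "complex \<Rightarrow> complex3 \<Rightarrow> complex3" where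
  "s_z C = (\<lambda>(x, y, z). (x, y, - z - x * y + C))"

definition g_x :: "complex \<Rightarrow> complex \<Rightarrow> complex3 \<Rightarrow> complex3" where
  "g_x B C = s_z C \<circ> s_y B"

definition g_y :: "complex \<Rightarrow> complex \<Rightarrow> complex3 \<Rightarrow> complex3" where
  "g_y A C = s_x A \<circ> s_z C"

definition g_z :: "complex \<Rightarrow> complex \<Rightarrow> complex3 \<Rightarrow> complex3" where
  "g_z A B = s_y B \<circ> s_x A"

(* Group elements are self-bijections of the surface, made total by the value undefined
   outside it; two of them are therefore equal iff they agree on the surface. *)
abbreviation BS ::
    "complex \<Rightarrow> complex \<Rightarrow> complex \<Rightarrow> complex \<Rightarrow> (complex3 \<Rightarrow> complex3) monoid" where
  "BS A B C D \<equiv> BijGroup (surface A B C D)"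

definition generators ::
    "complex \<Rightarrow> complex \<Rightarrow> complex \<Rightarrow> complex \<Rightarrow> (complex3 \<Rightarrow> complex3) set" where
  "generators A B C D =
     {restrict (g_x B C) (surface A B C D),
      restrict (g_y A C) (surface A B C D),
      restrict (g_z A B) (surface A B C D)}"

definition \<G> ::
    "complex \<Rightarrow> complex \<Rightarrow> complex \<Rightarrow> complex \<Rightarrow> (complex3 \<Rightarrow> complex3) set" where
  "\<G> A B C D = generate (BS A B C D) (generators A B C D)"

abbreviation open_in_surface ::
    "complex \<Rightarrow> complex \<Rightarrow> complex \<Rightarrow> complex \<Rightarrow> complex3 set \<Rightarrow> bool" where
  "open_in_surface A B C D U \<equiv> openin (top_of_set (surface A B C D)) U"

(* Meant for U open in the surface; openness is required where the predicate is used. *)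
definition locally_nondiscrete_on ::
    "complex \<Rightarrow> complex \<Rightarrow> complex \<Rightarrow> complex \<Rightarrow> complex3 set \<Rightarrow> bool" where
  "locally_nondiscrete_on A B C D U \<longleftrightarrow>
     (\<exists>f :: nat \<Rightarrow> complex3 \<Rightarrow> complex3.
        (\<forall>n. f n \<in> \<G> A B C D - {\<one>\<^bsub>BS A B C D\<^esub>}) \<and>
        (\<forall>K. compact K \<and> K \<subseteq> U \<longrightarrow> uniform_limit K f (\<lambda>p. p) sequentially))"

abbreviation locally_discrete_on ::
    "complex \<Rightarrow> complex \<Rightarrow> complex \<Rightarrow> complex \<Rightarrow> complex3 set \<Rightarrow> bool" where
  "locally_discrete_on A B C D U \<equiv> \<not> locally_nondiscrete_on A B C D U"

definition \<N> :: "complex \<Rightarrow> complex \<Rightarrow> complex \<Rightarrow> complex \<Rightarrow> complex3 set" where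
  "\<N> A B C D =
     {p \<in> surface A B C D.
        \<exists>W. open_in_surface A B C D W \<and> p \<in> W \<and> locally_nondiscrete_on A B C D W}"

definition \<D> :: "complex \<Rightarrow> complex \<Rightarrow> complex \<Rightarrow> complex \<Rightarrow> complex3 set" where
  "\<D> A B C D = surface A B C D - \<N> A B C D"

(* As for local non-discreteness, V is meant to be open in the surface;
   V is not required to be invariant under the group. *)
definition properly_discontinuous_on ::
    "complex \<Rightarrow> complex \<Rightarrow> complex \<Rightarrow> complex \<Rightarrow> complex3 set \<Rightarrow> bool" where
  "properly_discontinuous_on A B C D V \<longleftrightarrow>
     (\<forall>K. compact K \<and> K \<subseteq> V \<longrightarrow> finite {\<gamma> \<in> \<G> A B C D. \<gamma> ` K \<inter> K \<noteq> {}})"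

definition param_ABC :: "real \<Rightarrow> complex" where
  "param_ABC a = complex_of_real (2 * a + 4)"

definition param_D :: "real \<Rightarrow> complex" where
  "param_D a = complex_of_real (- (a\<^sup>2 + 8 * a + 8))"

lemma surface_iff:
  "(x, y, z) \<in> surface A B C D \<longleftrightarrow>
     x\<^sup>2 + y\<^sup>2 + z\<^sup>2 + x * y * z - (A * x + B * y + C * z) = D"
  by (auto simp: surface_def algebra_simps)

lemma s_x_surface: "p \<in> surface A B C D \<Longrightarrow> s_x A p \<in> surface A B C D"
  by (cases p) (simp add: surface_iff s_x_def algebra_simps power2_eq_square)

lemma s_y_surface: "p \<in> surface A B C D \<Longrightarrow> s_y B p \<in> surface A B C D"
  by (cases p) (simp add: surface_iff s_y_def algebra_simps power2_eq_square)

lemma s_z_surface: "p \<in> surface A B C D \<Longrightarrow> s_z C p \<in> surface A B C D"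
  by (cases p) (simp add: surface_iff s_z_def algebra_simps power2_eq_square)

lemma involutions [simp]:
  "s_x A (s_x A p) = p" "s_y B (s_y B p) = p" "s_z C (s_z C p) = p"
  by (cases p; simp add: s_x_def s_y_def s_z_def)+

lemma generators_subset: "generators A B C D \<subseteq> carrier (BS A B C D)"
proof -
  let ?S = "surface A B C D"
  have "bij_betw (g_x B C) ?S ?S"
    by (rule bij_betw_byWitness[where f' = "s_y B \<circ> s_z C"])
       (auto simp: g_x_def s_y_surface s_z_surface)
  moreover have "bij_betw (g_y A C) ?S ?S"
    by (rule bij_betw_byWitness[where f' = "s_z C \<circ> s_x A"])
       (auto simp: g_y_def s_x_surface s_z_surface)
  moreover have "bij_betw (g_z A B) ?S ?S"
    by (rule bij_betw_byWitness[where f' = "s_x A \<circ> s_y B"])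
       (auto simp: g_z_def s_x_surface s_y_surface)
  ultimately show ?thesis
    by (auto simp: generators_def BijGroup_def Bij_def)
qed

lemma subgroup_\<G>: "subgroup (\<G> A B C D) (BS A B C D)"
  unfolding \<G>_def
  by (rule group.generate_is_subgroup[OF group_BijGroup generators_subset])

end

theory Submission
  imports Defs "HOL-Complex_Analysis.Complex_Analysis"
begin

text \<open>The set \<open>V\<close> consists of surface points near a point \<open>(t, t, t)\<close> with \<open>t < -2\<close>. There all
  coordinates have modulus greater than 2, and along every reduced word in the three involutions
  the coordinate moved last becomes the largest one and exceeds every coordinate of a point of
  \<open>V\<close>. So nontrivial group elements move \<open>V\<close> off itself, and they act freely enough for
  ping-pong.

  The set \<open>U\<close> is a small ball around a common fixed point \<open>(a, y, z)\<close>, \<open>\<bar>a\<bar> < 2\<close>, of the unperturbed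
  involutions. The derivative of \<open>s_z s_y\<close> there is elliptic, so some power \<open>f\<close> of this map and
  its conjugate \<open>s_x f s_x\<close> are as close to the identity as desired, relative to the size of the
  ball; this persists for nearby parameters. By the Cauchy estimates the commutator of two such
  maps is quadratically closer to the identity, so iterated commutators converge to the identity
  on a smaller ball, and ping-pong on the orbit of a point of \<open>V\<close> shows that they never
  commute.\<close>

section \<open>Words in the involutions\<close>

datatype letter = LX | LY | LZ

fun flip :: "complex3 \<Rightarrow> letter \<Rightarrow> complex3 \<Rightarrow> complex3" where
  "flip (A, B, C) LX = s_x A"
| "flip (A, B, C) LY = s_y B"
| "flip (A, B, C) LZ = s_z C"

text \<open>Words act on all of C^3, not only on one surface, so that the estimates can use full
  balls of C^3 and complex lines in them. The letters are applied from right to left.\<close>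

primrec act :: "complex3 \<Rightarrow> letter list \<Rightarrow> complex3 \<Rightarrow> complex3" where
  "act q [] = id"
| "act q (c # w) = flip q c \<circ> act q w"

lemma flip_flip [simp]: "flip q c (flip q c p) = p"
  by (cases q; cases c) auto

lemma act_append: "act q (w @ v) p = act q w (act q v p)"
  by (induction w) auto

lemma act_rev_act [simp]: "act q (rev w) (act q w p) = p"
  by (induction w arbitrary: p) (auto simp: act_append)

lemma act_act_rev [simp]: "act q w (act q (rev w) p) = p"
  using act_rev_act[of q "rev w" p] by simp

lemma flip_surface: "p \<in> surface A B C D \<Longrightarrow> flip (A, B, C) c p \<in> surface A B C D"
  by (cases c) (auto simp: s_x_surface s_y_surface s_z_surface)

lemma act_surface: "p \<in> surface A B C D \<Longrightarrow> act (A, B, C) w p \<in> surface A B C D"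
  by (induction w) (auto simp: flip_surface)

text \<open>The flips are involutions, so a letter put before an equal first letter cancels it, and
  before a different one it keeps the word reduced.\<close>

lemma exists_reduced_word: "\<exists>v. distinct_adj v \<and> act q v = act q w"
proof (induction w)
  case Nil
  show ?case by (rule exI[of _ "[]"]) auto
next
  case (Cons c w)
  then obtain v where v: "distinct_adj v" "act q v = act q w" by auto
  show ?case
  proof (cases "v \<noteq> [] \<and> hd v = c")
    case True
    then obtain u where u: "v = c # u" by (cases v) auto
    have "act q (c # w) = act q u"
      by (simp add: v(2)[symmetric] u fun_eq_iff)
    with v(1) u show ?thesis
      by (metis distinct_adj_ConsD)
  next
    case False
    hence "distinct_adj (c # v)" using v(1) by (cases v) auto
    thus ?thesis using v(2) by (intro exI[of _ "c # v"]) auto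
  qed
qed

section \<open>Words as elements of the group\<close>

abbreviation word_map ::
    "complex \<Rightarrow> complex \<Rightarrow> complex \<Rightarrow> complex \<Rightarrow> letter list \<Rightarrow> complex3 \<Rightarrow> complex3" where
  "word_map A B C D w \<equiv> restrict (act (A, B, C) w) (surface A B C D)"

lemma word_map_carrier: "word_map A B C D w \<in> carrier (BS A B C D)"
proof -
  have "bij_betw (act (A, B, C) w) (surface A B C D) (surface A B C D)"
    by (rule bij_betw_byWitness[where f' = "act (A, B, C) (rev w)"]) (auto simp: act_surface)
  thus ?thesis by (simp add: BijGroup_def Bij_def)
qed

lemma word_map_mult:
  "word_map A B C D w \<otimes>\<^bsub>BS A B C D\<^esub> word_map A B C D v = word_map A B C D (w @ v)"
  using word_map_carrier[of A B C w D] word_map_carrier[of A B C v D]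
  by (auto simp: BijGroup_def compose_def fun_eq_iff act_append act_surface)

lemma word_map_Nil: "word_map A B C D [] = \<one>\<^bsub>BS A B C D\<^esub>"
  by (auto simp: BijGroup_def fun_eq_iff)

lemma word_map_inv: "inv\<^bsub>BS A B C D\<^esub> word_map A B C D w = word_map A B C D (rev w)"
proof (rule group.inv_equality[OF group_BijGroup _ word_map_carrier word_map_carrier])
  have "act (A, B, C) (rev w @ w) = act (A, B, C) []"
    by (auto simp: fun_eq_iff act_append)
  thus "word_map A B C D (rev w) \<otimes>\<^bsub>BS A B C D\<^esub> word_map A B C D w = \<one>\<^bsub>BS A B C D\<^esub>"
    unfolding word_map_mult by (simp only: word_map_Nil)
qed

lemma generators_eq_word_maps:
  "generators A B C D = word_map A B C D ` {[LZ, LY], [LX, LZ], [LY, LX]}"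
  by (auto simp: generators_def g_x_def g_y_def g_z_def)

lemma \<G>_word_map:
  assumes "\<gamma> \<in> \<G> A B C D"
  obtains w where "\<gamma> = word_map A B C D w" "distinct_adj w"
proof -
  have "\<exists>w. \<gamma> = word_map A B C D w"
    using assms unfolding \<G>_def
  proof (induction rule: generate.induct)
    case one
    show ?case using word_map_Nil[of A B C D] by metis
  next
    case (incl h)
    thus ?case unfolding generators_eq_word_maps by blast
  next
    case (inv h)
    thus ?case unfolding generators_eq_word_maps using word_map_inv by blast
  next
    case (eng h1 h2)
    thus ?case using word_map_mult by blast
  qed
  thus ?thesis using exists_reduced_word that by metis
qed

text \<open>An even word splits into pairs of letters, and each pair is a generator, the inverse of
  one, or trivial.\<close>

lemma even_word_map_in_\<G>:
  assumes "even (length w)"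
  shows "word_map A B C D w \<in> \<G> A B C D"
  using assms
proof (induction w rule: induct_list012)
  case 1
  show ?case unfolding word_map_Nil \<G>_def by (rule generate.one)
next
  case (3 c d w)
  interpret G: subgroup "\<G> A B C D" "BS A B C D" by (rule subgroup_\<G>)
  have gen: "word_map A B C D v \<in> \<G> A B C D"
    if "v \<in> {[LZ, LY], [LX, LZ], [LY, LX]}" for v
    unfolding \<G>_def generators_eq_word_maps by (rule generate.incl) (use that in blast)
  have gen_inv: "word_map A B C D (rev v) \<in> \<G> A B C D"
    if "v \<in> {[LZ, LY], [LX, LZ], [LY, LX]}" for v
    using G.m_inv_closed[OF gen[OF that]] by (simp only: word_map_inv)
  have "act (A, B, C) [e, e] = act (A, B, C) []" for e
    by (auto simp: fun_eq_iff)
  hence triv: "word_map A B C D [e, e] \<in> \<G> A B C D" for e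
    by (simp only: word_map_Nil G.one_closed)
  have "word_map A B C D [c, d] \<in> \<G> A B C D"
    using gen[of "[c, d]"] gen_inv[of "[d, c]"] triv[of c] by (cases c; cases d) auto
  moreover have "word_map A B C D w \<in> \<G> A B C D"
    by (rule 3(1)) (use 3(3) in simp)
  ultimately have "word_map A B C D ([c, d] @ w) \<in> \<G> A B C D"
    unfolding word_map_mult[symmetric] by (rule G.m_closed)
  thus ?case by (simp only: append_Cons append_Nil)
qed auto

section \<open>The properly discontinuous region\<close>

text \<open>The bound \<open>hi\<close> keeps these regions off the shell. The bound
  \<open>lo\<close> on the other two coordinates is what makes the next flip grow.\<close>

fun dominant :: "real \<Rightarrow> real \<Rightarrow> letter \<Rightarrow> complex3 \<Rightarrow> bool" where
  "dominant lo hi LX (x, y, z) \<longleftrightarrow>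
     lo < norm y \<and> lo < norm z \<and> norm y < norm x \<and> norm z < norm x \<and> hi \<le> norm x"
| "dominant lo hi LY (x, y, z) \<longleftrightarrow>
     lo < norm x \<and> lo < norm z \<and> norm x < norm y \<and> norm z < norm y \<and> hi \<le> norm y"
| "dominant lo hi LZ (x, y, z) \<longleftrightarrow>
     lo < norm x \<and> lo < norm y \<and> norm x < norm z \<and> norm y < norm z \<and> hi \<le> norm z"

definition shell :: "real \<Rightarrow> real \<Rightarrow> complex3 set" where
  "shell lo hi = {(x, y, z). {norm x, norm y, norm z} \<subseteq> {lo<..<hi}}"

text \<open>The condition on \<open>A\<close> says that a product of two numbers above
  \<open>lo\<close>, reduced by \<open>hi\<close> and by \<open>norm A\<close>, still exceeds
  \<open>hi\<close>; likewise for \<open>B\<close> and \<open>C\<close>.\<close>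

fun separated :: "real \<Rightarrow> real \<Rightarrow> complex3 \<Rightarrow> bool" where
  "separated lo hi (A, B, C) \<longleftrightarrow> 2 < lo \<and> lo \<le> hi \<and>
     norm A < lo\<^sup>2 - 2 * hi \<and> norm B < lo\<^sup>2 - 2 * hi \<and> norm C < lo\<^sup>2 - 2 * hi"

lemma norm_flip_lower:
  fixes x y z A :: complex
  shows "norm y * norm z - norm x - norm A \<le> norm (- x - y * z + A)"
proof -
  have "norm (y * z) \<le> norm (- x - y * z + A) + norm x + norm A"
    using norm_triangle_ineq4[of "A - x" "- x - y * z + A"] norm_triangle_ineq4[of A x]
    by (auto simp: algebra_simps)
  thus ?thesis by (simp add: norm_mult)
qed

lemma flip_bound_first:
  fixes x y z A :: complex
  assumes "2 < lo" "norm A < lo\<^sup>2 - 2 * hi" "lo < norm y" "lo < norm z" "norm x < hi"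
  shows "hi < norm (- x - y * z + A)"
proof -
  have "lo * lo \<le> norm y * norm z" using assms by (intro mult_mono) auto
  thus ?thesis using norm_flip_lower[of y z x A] assms by (simp add: power2_eq_square)
qed

text \<open>The new coordinate has norm at least \<open>lo * norm y - norm y - norm A\<close>. It
  exceeds \<open>norm y\<close> because
  \<open>norm A < lo * (lo - 2) \<le> (lo - 2) * norm y\<close>.\<close>

lemma flip_bound_next:
  fixes x y z A :: complex
  assumes "2 < lo" "lo \<le> hi" "norm A < lo\<^sup>2 - 2 * hi" "lo < norm z" "norm x < norm y" "hi \<le> norm y"
  shows "norm y < norm (- x - y * z + A)"
proof -
  have "lo * norm y \<le> norm y * norm z" using assms by (subst mult.commute) (intro mult_left_mono; simp)
  moreover have "(lo - 2) * lo \<le> (lo - 2) * norm y" using assms by (intro mult_left_mono) auto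
  ultimately show ?thesis
    using norm_flip_lower[of y z x A] assms by (simp add: power2_eq_square algebra_simps)
qed

lemma dominant_flip_shell:
  assumes "separated lo hi q" "p \<in> shell lo hi"
  shows "dominant lo hi c (flip q c p)"
proof -
  obtain A B C x y z where [simp]: "q = (A, B, C)" "p = (x, y, z)" by (metis prod_cases3)
  have *: "2 < lo" "norm A < lo\<^sup>2 - 2 * hi" "norm B < lo\<^sup>2 - 2 * hi" "norm C < lo\<^sup>2 - 2 * hi"
     "lo < norm x" "lo < norm y" "lo < norm z" "norm x < hi" "norm y < hi" "norm z < hi"
    using assms by (auto simp: shell_def)
  show ?thesis
    using * flip_bound_first[of lo A hi y z x] flip_bound_first[of lo B hi x z y]
      flip_bound_first[of lo C hi x y z]
    by (cases c) (auto simp: s_x_def s_y_def s_z_def)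
qed

text \<open>Flipping a coordinate other than the largest one replaces it by something larger still,
  by \<open>flip_bound_next\<close> in each of the six cases.\<close>

lemma dominant_flip:
  assumes "separated lo hi q" "dominant lo hi d p" "c \<noteq> d"
  shows "dominant lo hi c (flip q c p)"
proof -
  obtain A B C x y z where [simp]: "q = (A, B, C)" "p = (x, y, z)" by (metis prod_cases3)
  have *: "2 < lo" "lo \<le> hi" "norm A < lo\<^sup>2 - 2 * hi" "norm B < lo\<^sup>2 - 2 * hi" "norm C < lo\<^sup>2 - 2 * hi"
    using assms by auto
  show ?thesis
    using assms(2,3) * flip_bound_next[of lo hi A z x y] flip_bound_next[of lo hi B z y x]
      flip_bound_next[of lo hi C y z x] flip_bound_next[of lo hi A y x z]
      flip_bound_next[of lo hi B x y z] flip_bound_next[of lo hi C x z y]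
    by (cases c; cases d) (auto simp: s_x_def s_y_def s_z_def mult.commute)
qed

lemma dominant_unique: "dominant lo hi c p \<Longrightarrow> dominant lo hi d p \<Longrightarrow> c = d"
  by (cases p; cases c; cases d) auto

lemma dominant_not_shell: "dominant lo hi c p \<Longrightarrow> p \<notin> shell lo hi"
  by (cases p; cases c) (auto simp: shell_def)

lemma dominant_act:
  assumes "separated lo hi q" "p \<in> shell lo hi" "distinct_adj w" "w \<noteq> []"
  shows "dominant lo hi (hd w) (act q w p)"
  using assms(3,4)
proof (induction w)
  case (Cons c w)
  show ?case
  proof (cases w)
    case Nil
    thus ?thesis using dominant_flip_shell[OF assms(1,2)] by simp
  next
    case (Cons d w')
    thus ?thesis using Cons.IH Cons.prems dominant_flip[OF assms(1), of d _ c] by simp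
  qed
qed auto

lemma shell_displaced:
  assumes "separated lo hi (A, B, C)" "\<gamma> \<in> \<G> A B C D" "\<gamma> \<noteq> \<one>\<^bsub>BS A B C D\<^esub>"
    and "p \<in> surface A B C D \<inter> shell lo hi"
  shows "\<gamma> p \<notin> shell lo hi"
proof -
  obtain w where w: "\<gamma> = word_map A B C D w" "distinct_adj w"
    using \<G>_word_map[OF assms(2)] .
  hence "w \<noteq> []" using assms(3) word_map_Nil[of A B C D] by metis
  thus ?thesis
    using dominant_not_shell dominant_act[OF assms(1) _ w(2), of p] assms(4) w(1) by auto
qed

lemma open_shell: "open (shell lo hi)"
proof -
  have "shell lo hi = {p. lo < norm (fst p) \<and> norm (fst p) < hi} \<inter>
      {p. lo < norm (fst (snd p)) \<and> norm (fst (snd p)) < hi} \<inter>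
      {p. lo < norm (snd (snd p)) \<and> norm (snd (snd p)) < hi}"
    by (auto simp: shell_def)
  also have "open \<dots>"
    by (intro open_Int open_Collect_conj open_Collect_less continuous_intros)
  finally show ?thesis .
qed

lemma properly_discontinuous_on_shell:
  assumes "separated lo hi (A, B, C)"
  shows "properly_discontinuous_on A B C D (surface A B C D \<inter> shell lo hi)"
  unfolding properly_discontinuous_on_def
proof (intro allI impI)
  fix K assume K: "compact K \<and> K \<subseteq> surface A B C D \<inter> shell lo hi"
  have "{\<gamma> \<in> \<G> A B C D. \<gamma> ` K \<inter> K \<noteq> {}} \<subseteq> {\<one>\<^bsub>BS A B C D\<^esub>}"
    using shell_displaced[OF assms] K by blast
  thus "finite {\<gamma> \<in> \<G> A B C D. \<gamma> ` K \<inter> K \<noteq> {}}"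
    using finite_subset by blast
qed

text \<open>Convergence at the single point \<open>p\<close> is already contradictory: the shell is
  open, so some \<open>f n p\<close> would return to it, but nontrivial elements move
  \<open>p\<close> out of it.\<close>

lemma locally_discrete_at_shell:
  assumes sep: "separated lo hi (A, B, C)"
    and p: "p \<in> surface A B C D \<inter> shell lo hi" "p \<in> W"
  shows "locally_discrete_on A B C D W"
proof
  assume "locally_nondiscrete_on A B C D W"
  then obtain f where f: "\<And>n. f n \<in> \<G> A B C D - {\<one>\<^bsub>BS A B C D\<^esub>}"
    and lim: "\<And>K. compact K \<Longrightarrow> K \<subseteq> W \<Longrightarrow> uniform_limit K f (\<lambda>p. p) sequentially"
    unfolding locally_nondiscrete_on_def by blast
  have "(\<lambda>n. f n p) \<longlonglongrightarrow> p"
    by (rule tendsto_uniform_limitI[OF lim[of "{p}"]]) (use p in auto)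
  hence "\<forall>\<^sub>F n in sequentially. f n p \<in> shell lo hi"
    using open_shell p(1) topological_tendstoD by blast
  then obtain n where "f n p \<in> shell lo hi"
    using eventually_happens'[OF sequentially_bot] by blast
  thus False using shell_displaced[OF sep _ _ p(1)] f[of n] by blast
qed

section \<open>Commutators of maps close to the identity\<close>

text \<open>Along complex lines the coordinates of a word map are entire functions of one variable,
  to which the Cauchy inequality applies.\<close>

definition complex_line :: "complex3 \<Rightarrow> complex3 \<Rightarrow> complex \<Rightarrow> complex3" where
  "complex_line s v l =
     (fst s + l * fst v, fst (snd s) + l * fst (snd v), snd (snd s) + l * snd (snd v))"

lemma complex_line_0 [simp]: "complex_line s v 0 = s"
  and complex_line_1 [simp]: "complex_line s v 1 = s + v"
  by (auto simp: complex_line_def prod_eq_iff)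

lemma dist_complex_line: "dist s (complex_line s v l) = norm l * norm v"
proof -
  obtain a b c where v: "v = (a, b, c)" by (metis prod_cases3)
  have "dist s (complex_line s v l) = norm (l * a, l * b, l * c)"
    by (cases s) (simp add: v complex_line_def dist_norm norm_Pair norm_minus_commute)
  also have "\<dots> = norm l * norm v"
    by (simp add: v norm_Pair norm_mult power_mult_distrib flip: distrib_left)
       (simp add: real_sqrt_mult)
  finally show ?thesis .
qed

lemma act_complex_line_holomorphic:
  "(\<lambda>l. fst (act q w (complex_line s v l))) holomorphic_on UNIV \<and>
   (\<lambda>l. fst (snd (act q w (complex_line s v l)))) holomorphic_on UNIV \<and>
   (\<lambda>l. snd (snd (act q w (complex_line s v l)))) holomorphic_on UNIV"
proof (induction w)
  case Nil
  show ?case by (auto simp: complex_line_def intro!: holomorphic_intros)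
next
  case (Cons c w)
  thus ?case
    by (cases q; cases c)
       (auto simp: s_x_def s_y_def s_z_def case_prod_beta intro!: holomorphic_intros)
qed

text \<open>The Cauchy inequality on discs of radius \<open>\<rho>\<close> about points of the
  closed unit disc bounds the derivative there; integrating this bound from 0 to 1 gives the
  increment.\<close>

lemma entire_increment_bound:
  fixes f :: "complex \<Rightarrow> complex"
  assumes hol: "f holomorphic_on UNIV" and \<rho>: "0 < \<rho>"
    and bound: "\<And>l. norm l \<le> 1 + \<rho> \<Longrightarrow> norm (f l) \<le> \<delta>"
  shows "norm (f 1 - f 0) \<le> \<delta> / \<rho>"
proof -
  have deriv: "norm (deriv f z) \<le> \<delta> / \<rho>" if "z \<in> cball 0 1" for z
  proof -
    have "norm ((deriv ^^ 1) f z) \<le> fact 1 * \<delta> / \<rho> ^ 1"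
    proof (rule Cauchy_inequality[OF _ _ \<rho>])
      show "f holomorphic_on ball z \<rho>" using hol holomorphic_on_subset by blast
      show "continuous_on (cball z \<rho>) f"
        using hol holomorphic_on_imp_continuous_on holomorphic_on_subset by blast
      fix x assume "norm (z - x) = \<rho>"
      hence "norm x \<le> 1 + \<rho>" using that norm_triangle_ineq4[of z "z - x"] by simp
      thus "norm (f x) \<le> \<delta>" by (rule bound)
    qed
    thus ?thesis by simp
  qed
  have "norm (f 1 - f 0) \<le> \<delta> / \<rho> * norm (1 - 0 :: complex)"
  proof (rule field_differentiable_bound[of "cball 0 1" f "deriv f", OF convex_cball _ deriv])
    show "(f has_field_derivative deriv f z) (at z within cball 0 1)" if "z \<in> cball 0 1" for z
      using holomorphic_derivI[OF hol, of z] by (auto intro: has_field_derivative_at_within)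
  qed auto
  thus ?thesis by simp
qed

lemma norm_coordinates_le:
  fixes x :: complex3
  shows "norm (fst x) \<le> norm x" "norm (fst (snd x)) \<le> norm x" "norm (snd (snd x)) \<le> norm x"
  using norm_fst_le[of "fst x" "snd x"] norm_snd_le[of "snd x" "fst x"]
    norm_fst_le[of "fst (snd x)" "snd (snd x)"] norm_snd_le[of "snd (snd x)" "fst (snd x)"]
  by auto

lemma norm_le_coordinates:
  fixes x :: complex3
  shows "norm x \<le> norm (fst x) + (norm (fst (snd x)) + norm (snd (snd x)))"
  using norm_Pair_le[of "fst x" "snd x"] norm_Pair_le[of "fst (snd x)" "snd (snd x)"] by auto

definition displacement_le ::
    "complex3 \<Rightarrow> letter list \<Rightarrow> complex3 \<Rightarrow> real \<Rightarrow> real \<Rightarrow> bool" where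
  "displacement_le q w p0 R \<delta> \<longleftrightarrow> (\<forall>x\<in>ball p0 R. norm (act q w x - x) \<le> \<delta>)"

lemma displacement_leD: "displacement_le q w p0 R \<delta> \<Longrightarrow> dist p0 x < R \<Longrightarrow> norm (act q w x - x) \<le> \<delta>"
  by (auto simp: displacement_le_def)

lemma displacement_le_mono:
  "displacement_le q w p0 R \<delta> \<Longrightarrow> R' \<le> R \<Longrightarrow> \<delta> \<le> \<delta>' \<Longrightarrow> displacement_le q w p0 R' \<delta>'"
  unfolding displacement_le_def using subset_ball[of R' R p0] by (meson order_trans subsetD)

text \<open>The factor 3 is the price for applying the one-variable Cauchy estimate to each coordinate.\<close>

lemma displacement_lipschitz:
  assumes disp: "displacement_le q w p0 R \<delta>" and \<tau>: "0 < \<tau>"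
    and room: "dist p0 s + norm v + \<tau> < R"
  shows "norm ((act q w (s + v) - (s + v)) - (act q w s - s)) \<le> 3 * (\<delta> * norm v / \<tau>)"
proof (cases "v = 0")
  case False
  \<comment> \<open>Scaled so that the parameters with \<open>norm l \<le> 1 + \<rho>\<close> give
    points at distance at most \<open>norm v + \<tau>\<close> from \<open>s\<close>, which stay in
    the ball.\<close>
  define \<rho> where "\<rho> = \<tau> / norm v"
  have \<rho>: "0 < \<rho>" using \<tau> False by (simp add: \<rho>_def)
  define F where "F = (\<lambda>l. act q w (complex_line s v l) - complex_line s v l)"
  have bound: "norm (F l) \<le> \<delta>" if "norm l \<le> 1 + \<rho>" for l
  proof -
    have "norm l * norm v \<le> (1 + \<rho>) * norm v" using that by (intro mult_right_mono) auto
    also have "\<dots> = norm v + \<tau>" using False by (simp add: \<rho>_def field_simps)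
    finally have "dist p0 (complex_line s v l) < R"
      using dist_triangle[of p0 "complex_line s v l" s] dist_complex_line[of s v l] room
      by linarith
    thus ?thesis using displacement_leD[OF disp] by (simp add: F_def)
  qed
  have coord: "norm (fst (F 1) - fst (F 0)) \<le> \<delta> / \<rho>"
    "norm (fst (snd (F 1)) - fst (snd (F 0))) \<le> \<delta> / \<rho>"
    "norm (snd (snd (F 1)) - snd (snd (F 0))) \<le> \<delta> / \<rho>"
  proof -
    note hol = act_complex_line_holomorphic[of q w s v]
    show "norm (fst (F 1) - fst (F 0)) \<le> \<delta> / \<rho>"
    proof (rule entire_increment_bound[OF _ \<rho>])
      show "(\<lambda>l. fst (F l)) holomorphic_on UNIV"
        using hol by (auto simp: F_def complex_line_def intro!: holomorphic_intros)
    qed (blast intro: order_trans[OF norm_coordinates_le(1) bound])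
    show "norm (fst (snd (F 1)) - fst (snd (F 0))) \<le> \<delta> / \<rho>"
    proof (rule entire_increment_bound[OF _ \<rho>])
      show "(\<lambda>l. fst (snd (F l))) holomorphic_on UNIV"
        using hol by (auto simp: F_def complex_line_def intro!: holomorphic_intros)
    qed (blast intro: order_trans[OF norm_coordinates_le(2) bound])
    show "norm (snd (snd (F 1)) - snd (snd (F 0))) \<le> \<delta> / \<rho>"
    proof (rule entire_increment_bound[OF _ \<rho>])
      show "(\<lambda>l. snd (snd (F l))) holomorphic_on UNIV"
        using hol by (auto simp: F_def complex_line_def intro!: holomorphic_intros)
    qed (blast intro: order_trans[OF norm_coordinates_le(3) bound])
  qed
  have "norm (F 1 - F 0) \<le> norm (fst (F 1 - F 0)) +
      (norm (fst (snd (F 1 - F 0))) + norm (snd (snd (F 1 - F 0))))"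
    by (rule norm_le_coordinates)
  also have "\<dots> \<le> 3 * (\<delta> / \<rho>)" using coord by simp
  finally show ?thesis by (simp add: F_def \<rho>_def)
qed simp

text \<open>With \<open>f = id + \<phi>\<close> and \<open>g = id + \<psi>\<close> one has
  \<open>f g - g f = (\<phi> \<circ> g - \<phi>) - (\<psi> \<circ> f - \<psi>)\<close>, which is quadratically small.\<close>

lemma commutator_displacement:
  assumes w: "displacement_le q w p0 R \<delta>" "displacement_le q (rev w) p0 R \<delta>"
    and v: "displacement_le q v p0 R \<delta>" "displacement_le q (rev v) p0 R \<delta>"
    and \<tau>: "0 < \<tau>" and \<delta>: "0 \<le> \<delta>"
  shows "displacement_le q (w @ v @ rev w @ rev v) p0 (R - 4 * \<delta> - \<tau>) (6 * \<delta>\<^sup>2 / \<tau>)"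
  unfolding displacement_le_def
proof
  fix x assume "x \<in> ball p0 (R - 4 * \<delta> - \<tau>)"
  hence x: "dist p0 x < R - 4 * \<delta> - \<tau>" by simp
  define f g where "f = act q w" and "g = act q v"
  \<comment> \<open>Pulling \<open>x\<close> back to \<open>s\<close> removes the inverses:
    \<open>x = g (f s)\<close>, and the commutator takes \<open>x\<close> to \<open>f (g s)\<close>.
    All points used stay in the larger ball, since each map moves points by at most
    \<open>\<delta>\<close>.\<close>
  define s' where "s' = act q (rev v) x"
  define s where "s = act q (rev w) s'"
  have "norm (s' - x) \<le> \<delta>"
    unfolding s'_def by (rule displacement_leD[OF v(2)]) (use x \<tau> \<delta> in linarith)
  hence s': "dist p0 s' < R - 3 * \<delta> - \<tau>"
    using x dist_triangle[of p0 s' x] by (simp add: dist_norm norm_minus_commute)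
  have "norm (s - s') \<le> \<delta>"
    unfolding s_def by (rule displacement_leD[OF w(2)]) (use s' \<tau> \<delta> in linarith)
  hence s: "dist p0 s < R - 2 * \<delta> - \<tau>"
    using s' dist_triangle[of p0 s s'] by (simp add: dist_norm norm_minus_commute)
  have fs: "norm (f s - s) \<le> \<delta>"
    unfolding f_def by (rule displacement_leD[OF w(1)]) (use s \<tau> \<delta> in linarith)
  have gs: "norm (g s - s) \<le> \<delta>"
    unfolding g_def by (rule displacement_leD[OF v(1)]) (use s \<tau> \<delta> in linarith)
  have quad: "3 * (\<delta> * a / \<tau>) \<le> 3 * (\<delta> * \<delta> / \<tau>)" if "a \<le> \<delta>" for a
    using that \<delta> \<tau> by (auto intro!: divide_right_mono mult_left_mono)
  have *: "norm ((f (g s) - g s) - (f s - s)) \<le> 3 * (\<delta> * \<delta> / \<tau>)"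
    using displacement_lipschitz[OF w(1) \<tau>, of s "g s - s"] quad[OF gs] gs s \<delta>
    by (simp add: f_def)
  have **: "norm ((g (f s) - f s) - (g s - s)) \<le> 3 * (\<delta> * \<delta> / \<tau>)"
    using displacement_lipschitz[OF v(1) \<tau>, of s "f s - s"] quad[OF fs] fs s \<delta>
    by (simp add: g_def)
  have "x = g (f s)" by (simp add: s_def s'_def f_def g_def)
  moreover have "act q (w @ v @ rev w @ rev v) x = f (g s)"
    by (simp add: act_append f_def g_def s_def s'_def)
  moreover have "a - b = ((a - g') - (f' - s)) - ((b - f') - (g' - s))" for a b f' g' :: complex3
    by (simp add: algebra_simps)
  ultimately have "act q (w @ v @ rev w @ rev v) x - x =
      ((f (g s) - g s) - (f s - s)) - ((g (f s) - f s) - (g s - s))"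
    by metis
  also have "norm \<dots> \<le> 3 * (\<delta> * \<delta> / \<tau>) + 3 * (\<delta> * \<delta> / \<tau>)"
    by (rule order_trans[OF norm_triangle_ineq4 add_mono[OF * **]])
  also have "\<dots> = 6 * \<delta>\<^sup>2 / \<tau>"
    by (simp add: power2_eq_square)
  finally show "norm (act q (w @ v @ rev w @ rev v) x - x) \<le> 6 * \<delta>\<^sup>2 / \<tau>" .
qed

text \<open>This choice of the two commutators is the one for which ping-pong survives: passing from a pair
  to the next only permutes the four attracting sets.\<close>

primrec commutator_words :: "letter list \<Rightarrow> letter list \<Rightarrow> nat \<Rightarrow> letter list \<times> letter list" where
  "commutator_words w v 0 = (w, v)"
| "commutator_words w v (Suc k) =
     (let (a, b) = commutator_words w v k
      in (a @ b @ rev a @ rev b, rev a @ rev b @ a @ b))"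

lemma even_length_commutator_words:
  assumes "even (length w)" "even (length v)" "commutator_words w v k = (a, b)"
  shows "even (length a) \<and> even (length b)"
  using assms(3) by (induction k arbitrary: a b) (use assms(1,2) in \<open>auto split: prod.splits\<close>)

text \<open>The displacement halves at each step while the radius shrinks by a geometric series and
  stays above \<open>r / 2\<close>. Inverses are carried along because the commutator estimate needs
  bounds for them too.\<close>

lemma commutator_words_displacement:
  assumes r: "0 < r"
    and start: "displacement_le q w p0 r (r / 128)" "displacement_le q (rev w) p0 r (r / 128)"
      "displacement_le q v p0 r (r / 128)" "displacement_le q (rev v) p0 r (r / 128)"
    and eq: "commutator_words w v k = (a, b)" and u: "u \<in> {a, rev a, b, rev b}"
  shows "displacement_le q u p0 (r / 2 + r / 2 / 2 ^ k) (r / 128 / 2 ^ k)"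
  using eq u
proof (induction k arbitrary: a b u)
  case 0
  thus ?case using start by auto
next
  case (Suc k)
  obtain a' b' where ab': "commutator_words w v k = (a', b')" by fastforce
  define \<delta> where "\<delta> = r / 128 / 2 ^ k"
  \<comment> \<open>With this margin \<open>4 * \<delta> + \<tau>\<close> is 5/32 of
    \<open>r / 2 ^ k\<close>, below the permitted loss of 1/4, and
    \<open>6 * \<delta>\<^sup>2 / \<tau>\<close> is 3/1024 of it, below the required 1/256.\<close>
  define \<tau> where "\<tau> = r / 8 / 2 ^ k"
  have pos: "0 < \<tau>" "0 \<le> \<delta>" using r by (auto simp: \<delta>_def \<tau>_def)
  have IH: "displacement_le q u p0 (r / 2 + r / 2 / 2 ^ k) \<delta>" if "u \<in> {a', rev a', b', rev b'}" for u
    unfolding \<delta>_def by (rule Suc.IH[OF ab' that])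
  have comm: "displacement_le q (c @ d @ rev c @ rev d) p0
      (r / 2 + r / 2 / 2 ^ k - 4 * \<delta> - \<tau>) (6 * \<delta>\<^sup>2 / \<tau>)"
    if "c \<in> {a', rev a', b', rev b'}" "d \<in> {a', rev a', b', rev b'}" for c d
    by (rule commutator_displacement[OF IH IH IH IH pos]) (use that in auto)
  have radius: "r / 2 + r / 2 / 2 ^ Suc k \<le> r / 2 + r / 2 / 2 ^ k - 4 * \<delta> - \<tau>"
    using r by (simp add: \<delta>_def \<tau>_def field_simps)
  have size: "6 * \<delta>\<^sup>2 / \<tau> \<le> r / 128 / 2 ^ Suc k"
    using r by (simp add: \<delta>_def \<tau>_def field_simps power2_eq_square)
  \<comment> \<open>The inverses of the two new words are again commutators of the old words and
    their inverses.\<close>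
  have "u \<in> {a' @ b' @ rev a' @ rev b', b' @ a' @ rev b' @ rev a',
      rev a' @ rev b' @ a' @ b', rev b' @ rev a' @ b' @ a'}"
    using Suc.prems ab' by auto
  moreover have "displacement_le q (a' @ b' @ rev a' @ rev b') p0 (r / 2 + r / 2 / 2 ^ k - 4 * \<delta> - \<tau>) (6 * \<delta>\<^sup>2 / \<tau>)"
    "displacement_le q (b' @ a' @ rev b' @ rev a') p0 (r / 2 + r / 2 / 2 ^ k - 4 * \<delta> - \<tau>) (6 * \<delta>\<^sup>2 / \<tau>)"
    by (rule comm; simp)+
  moreover have "displacement_le q (rev a' @ rev b' @ a' @ b') p0 (r / 2 + r / 2 / 2 ^ k - 4 * \<delta> - \<tau>) (6 * \<delta>\<^sup>2 / \<tau>)"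
    "displacement_le q (rev b' @ rev a' @ b' @ a') p0 (r / 2 + r / 2 / 2 ^ k - 4 * \<delta> - \<tau>) (6 * \<delta>\<^sup>2 / \<tau>)"
    using comm[of "rev a'" "rev b'"] comm[of "rev b'" "rev a'"] by simp_all
  ultimately have "displacement_le q u p0 (r / 2 + r / 2 / 2 ^ k - 4 * \<delta> - \<tau>) (6 * \<delta>\<^sup>2 / \<tau>)"
    by blast
  thus ?case by (rule displacement_le_mono[OF _ radius size])
qed

section \<open>Ping-pong on an orbit\<close>

text \<open>\<open>X\<close> and \<open>X'\<close> attract \<open>w\<close> and its inverse,
  \<open>Y\<close> and \<open>Y'\<close> attract \<open>v\<close> and its inverse; each map is
  controlled outside the attracting set of its inverse.\<close>

definition ping_pong ::
    "complex3 \<Rightarrow> complex3 set \<Rightarrow> letter list \<Rightarrow> letter list \<Rightarrow>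
      complex3 set \<Rightarrow> complex3 set \<Rightarrow> complex3 set \<Rightarrow> complex3 set \<Rightarrow> bool" where
  "ping_pong q \<Omega> w v X X' Y Y' \<longleftrightarrow>
     X \<union> X' \<union> Y \<union> Y' \<subseteq> \<Omega> \<and>
     X \<inter> X' = {} \<and> X \<inter> Y = {} \<and> X \<inter> Y' = {} \<and> X' \<inter> Y = {} \<and> X' \<inter> Y' = {} \<and> Y \<inter> Y' = {} \<and>
     act q w ` (\<Omega> - X') \<subseteq> X \<and> act q (rev w) ` (\<Omega> - X) \<subseteq> X' \<and>
     act q v ` (\<Omega> - Y') \<subseteq> Y \<and> act q (rev v) ` (\<Omega> - Y) \<subseteq> Y'"

text \<open>A commutator sends points into the attracting set of its leftmost factor, provided they
  avoid that of the inverse of its rightmost factor. The new words and their inverses start with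
  \<open>w\<close>, \<open>v\<close>, \<open>rev w\<close> and \<open>rev v\<close>, so they receive
  the four disjoint sets \<open>X\<close>, \<open>Y\<close>, \<open>X'\<close> and
  \<open>Y'\<close>.\<close>

lemma ping_pong_commutators:
  assumes "ping_pong q \<Omega> w v X X' Y Y'"
  shows "ping_pong q \<Omega> (w @ v @ rev w @ rev v) (rev w @ rev v @ w @ v) X Y X' Y'"
proof -
  have disj: "X \<union> X' \<union> Y \<union> Y' \<subseteq> \<Omega>" "X \<inter> X' = {}" "X \<inter> Y = {}" "X \<inter> Y' = {}"
      "X' \<inter> Y = {}" "X' \<inter> Y' = {}" "Y \<inter> Y' = {}"
    and step: "\<And>p. p \<in> \<Omega> - X' \<Longrightarrow> act q w p \<in> X" "\<And>p. p \<in> \<Omega> - X \<Longrightarrow> act q (rev w) p \<in> X'"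
      "\<And>p. p \<in> \<Omega> - Y' \<Longrightarrow> act q v p \<in> Y" "\<And>p. p \<in> \<Omega> - Y \<Longrightarrow> act q (rev v) p \<in> Y'"
    using assms unfolding ping_pong_def by auto
  have rw: "p \<in> Y \<Longrightarrow> act q (rev w) p \<in> X'" "p \<in> Y' \<Longrightarrow> act q (rev w) p \<in> X'"
    and w: "p \<in> Y \<Longrightarrow> act q w p \<in> X" "p \<in> Y' \<Longrightarrow> act q w p \<in> X"
    and rv: "p \<in> X \<Longrightarrow> act q (rev v) p \<in> Y'" "p \<in> X' \<Longrightarrow> act q (rev v) p \<in> Y'"
    and v: "p \<in> X \<Longrightarrow> act q v p \<in> Y" "p \<in> X' \<Longrightarrow> act q v p \<in> Y" for p
    using disj by (auto intro!: step)
  have "act q w (act q v (act q (rev w) (act q (rev v) p))) \<in> X" if "p \<in> \<Omega> - Y" for p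
    using that by (intro w(1) v(2) rw(2) step(4))
  moreover have "act q v (act q w (act q (rev v) (act q (rev w) p))) \<in> Y" if "p \<in> \<Omega> - X" for p
    using that by (intro v(1) w(2) rv(2) step(2))
  moreover have "act q (rev w) (act q (rev v) (act q w (act q v p))) \<in> X'" if "p \<in> \<Omega> - Y'" for p
    using that by (intro rw(2) rv(1) w(1) step(3))
  moreover have "act q (rev v) (act q (rev w) (act q v (act q w p))) \<in> Y'" if "p \<in> \<Omega> - X'" for p
    using that by (intro rv(2) rw(1) v(1) step(1))
  ultimately show ?thesis
    unfolding ping_pong_def image_subset_iff using disj by (simp add: act_append Int_commute Un_ac)
qed

lemma ping_pong_commutator_words:
  assumes "ping_pong q \<Omega> w v X X' Y Y'" "p \<in> \<Omega> - (X \<union> X' \<union> Y \<union> Y')"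
    and "commutator_words w v k = (a, b)"
  shows "\<exists>X X' Y Y'. ping_pong q \<Omega> a b X X' Y Y' \<and> p \<in> \<Omega> - (X \<union> X' \<union> Y \<union> Y')"
  using assms(3)
proof (induction k arbitrary: a b)
  case 0
  thus ?case using assms(1,2) by auto
next
  case (Suc k)
  obtain a' b' where ab': "commutator_words w v k = (a', b')" by fastforce
  then obtain X X' Y Y' where "ping_pong q \<Omega> a' b' X X' Y Y'" "p \<in> \<Omega> - (X \<union> X' \<union> Y \<union> Y')"
    using Suc.IH by blast
  hence "ping_pong q \<Omega> (a' @ b' @ rev a' @ rev b') (rev a' @ rev b' @ a' @ b') X Y X' Y'"
    "p \<in> \<Omega> - (X \<union> Y \<union> X' \<union> Y')"
    using ping_pong_commutators by blast+
  moreover have "a = a' @ b' @ rev a' @ rev b'" "b = rev a' @ rev b' @ a' @ b'"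
    using Suc.prems ab' by simp_all
  ultimately show ?case
    by (intro exI[of _ X] exI[of _ Y] exI[of _ X'] exI[of _ Y'] conjI) (simp_all only:)
qed

text \<open>From a point outside the four sets, one product leads into \<open>X\<close> and the
  other into \<open>Y\<close>.\<close>

lemma ping_pong_noncommuting:
  assumes "ping_pong q \<Omega> w v X X' Y Y'" "p \<in> \<Omega> - (X \<union> X' \<union> Y \<union> Y')"
  shows "act q (w @ v) p \<noteq> act q (v @ w) p"
proof -
  note pp = assms(1)[unfolded ping_pong_def image_subset_iff]
  have sub: "X \<union> X' \<union> Y \<union> Y' \<subseteq> \<Omega>" "X \<inter> Y = {}" "X \<inter> Y' = {}" "X' \<inter> Y = {}"
    and w: "\<forall>x\<in>\<Omega> - X'. act q w x \<in> X" and v: "\<forall>x\<in>\<Omega> - Y'. act q v x \<in> Y"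
    using pp by simp_all
  have "act q v p \<in> Y" "act q w p \<in> X"
    using assms(2) w v by simp_all
  moreover from this have "act q v p \<in> \<Omega> - X'" "act q w p \<in> \<Omega> - Y'"
    using sub by blast+
  ultimately have "act q w (act q v p) \<in> X" "act q v (act q w p) \<in> Y"
    using w v by simp_all
  thus ?thesis using sub(2) unfolding act_append by (metis disjoint_iff)
qed

section \<open>The orbit of a shell point as a tree\<close>

inductive orbit :: "complex3 \<Rightarrow> complex3 \<Rightarrow> letter \<Rightarrow> complex3 \<Rightarrow> bool" for q p where
  first: "orbit q p c (flip q c p)"
| next_flip: "orbit q p d x \<Longrightarrow> c \<noteq> d \<Longrightarrow> orbit q p c (flip q c x)"

text \<open>A branch collects the points reached from \<open>p\<close> by a reduced word whose last
  flip is \<open>c\<close>. Under \<open>separated\<close>, dominance makes the three branches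
  disjoint when \<open>p\<close> is in the shell.\<close>

definition branch :: "complex3 \<Rightarrow> complex3 \<Rightarrow> letter \<Rightarrow> complex3 set" where
  "branch q p c = Collect (orbit q p c)"

definition whole_orbit :: "complex3 \<Rightarrow> complex3 \<Rightarrow> complex3 set" where
  "whole_orbit q p = insert p (\<Union>c. branch q p c)"

lemma orbit_dominant:
  assumes "separated lo hi q" "p \<in> shell lo hi" "orbit q p c x"
  shows "dominant lo hi c x"
  using assms(3)
proof induction
  case (first c)
  show ?case by (rule dominant_flip_shell[OF assms(1,2)])
next
  case (next_flip d x c)
  thus ?case using dominant_flip[OF assms(1)] by blast
qed

lemma root_notin_branch:
  assumes "separated lo hi q" "p \<in> shell lo hi"
  shows "p \<notin> branch q p c"
  unfolding branch_def using orbit_dominant[OF assms] dominant_not_shell assms(2) by blast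

lemma branch_disjoint:
  assumes "separated lo hi q" "p \<in> shell lo hi" "c \<noteq> d"
  shows "branch q p c \<inter> branch q p d = {}"
  unfolding branch_def using orbit_dominant[OF assms(1,2)] dominant_unique assms(3) by blast

text \<open>From \<open>p\<close> or from another branch, adding the flip \<open>c\<close> keeps the
  word reduced.\<close>

lemma flip_into_branch:
  assumes "x \<in> whole_orbit q p - branch q p c"
  shows "flip q c x \<in> branch q p c"
proof (cases "x = p")
  case True
  thus ?thesis by (simp add: branch_def orbit.first)
next
  case False
  then obtain d where "orbit q p d x" "d \<noteq> c"
    using assms by (auto simp: whole_orbit_def branch_def)
  thus ?thesis by (simp add: branch_def orbit.next_flip)
qed

lemma flip_out_of_branch:
  assumes "x \<in> branch q p c"
  shows "flip q c x \<in> whole_orbit q p"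
proof -
  have "orbit q p c x" using assms by (simp add: branch_def)
  thus ?thesis by cases (auto simp: whole_orbit_def branch_def)
qed

text \<open>\<open>alternating LZ LY n\<close> is the word of the n-th power of
  \<open>g_x\<close>.\<close>

definition alternating :: "letter \<Rightarrow> letter \<Rightarrow> nat \<Rightarrow> letter list" where
  "alternating c d n = concat (replicate n [c, d])"

lemma alternating_0 [simp]: "alternating c d 0 = []"
  and alternating_Suc [simp]: "alternating c d (Suc n) = c # d # alternating c d n"
  by (simp_all add: alternating_def)

lemma alternating_snoc: "alternating c d n @ [c, d] = alternating c d (Suc n)"
  by (induction n) auto

lemma rev_alternating: "rev (alternating c d n) = alternating d c n"
  using alternating_snoc by (induction n) auto

lemma even_length_alternating: "even (length (alternating c d n))"
  by (induction n) auto

text \<open>Flipping \<open>d\<close> and then \<open>c\<close> carries the complement of branch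
  \<open>d\<close> into branch \<open>c\<close>. Branch \<open>c\<close> lies in that complement, so
  the step can be repeated.\<close>

lemma alternating_into_branch:
  assumes sep: "separated lo hi q" "p \<in> shell lo hi" and "c \<noteq> d" "0 < n"
    and x: "x \<in> whole_orbit q p - branch q p d"
  shows "act q (alternating c d n) x \<in> branch q p c"
proof -
  have branch: "flip q c (flip q d y) \<in> branch q p c" if "y \<in> whole_orbit q p - branch q p d" for y
    using flip_into_branch[OF that] branch_disjoint[OF sep \<open>c \<noteq> d\<close>]
    by (intro flip_into_branch) (auto simp: whole_orbit_def)
  have sub: "branch q p c \<subseteq> whole_orbit q p - branch q p d"
    using branch_disjoint[OF sep \<open>c \<noteq> d\<close>] by (auto simp: whole_orbit_def)
  have "act q (alternating c d (Suc m)) x \<in> branch q p c" for m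
  proof (induction m)
    case 0
    show ?case using branch[OF x] by simp
  next
    case (Suc m)
    from branch[OF subsetD[OF sub this]] show ?case by simp
  qed
  thus ?thesis using \<open>0 < n\<close> by (metis gr0_conv_Suc)
qed

text \<open>The second element is the conjugate of the first by \<open>s_x\<close>; the conjugating flip
  moves the attracting sets of the first into the branch of \<open>LX\<close>.\<close>

lemma ping_pong_start:
  assumes sep: "separated lo hi q" "p \<in> shell lo hi" and n: "0 < n"
  defines "w \<equiv> alternating LZ LY n"
  shows "ping_pong q (whole_orbit q p) w ([LX] @ w @ [LX])
    (branch q p LZ) (branch q p LY) (flip q LX ` branch q p LZ) (flip q LX ` branch q p LY)"
proof -
  let ?\<Omega> = "whole_orbit q p" and ?E = "branch q p"
  note disj = branch_disjoint[OF sep]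
  have sub: "?E c \<subseteq> ?\<Omega>" for c by (auto simp: whole_orbit_def)
  have w: "act q w x \<in> ?E LZ" if "x \<in> ?\<Omega> - ?E LY" for x
    unfolding w_def by (rule alternating_into_branch[OF sep _ n that]) simp
  have rw: "act q (rev w) x \<in> ?E LY" if "x \<in> ?\<Omega> - ?E LZ" for x
    unfolding w_def rev_alternating by (rule alternating_into_branch[OF sep _ n that]) simp
  have in_x: "flip q LX ` ?E c \<subseteq> ?E LX" if "c \<noteq> LX" for c
    using flip_into_branch sub[of c] disj[OF that] by blast
  have out_x: "flip q LX x \<in> ?\<Omega> - ?E c" if "x \<in> ?\<Omega> - flip q LX ` ?E c" "c \<noteq> LX" for x c
  proof -
    have "flip q LX x \<notin> ?E c"
    proof
      assume "flip q LX x \<in> ?E c"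
      hence "flip q LX (flip q LX x) \<in> flip q LX ` ?E c" by (rule imageI)
      thus False using that(1) by simp
    qed
    \<comment> \<open>A point of the branch of \<open>LX\<close> has its last flip undone; any other
      point enters that branch.\<close>
    moreover have "flip q LX x \<in> ?\<Omega>"
      using that(1) flip_out_of_branch flip_into_branch sub[of LX] by blast
    ultimately show ?thesis by blast
  qed
  have Y: "flip q LX ` ?E LZ \<subseteq> ?E LX" "flip q LX ` ?E LY \<subseteq> ?E LX"
    using in_x by simp_all
  have E: "?E LZ \<inter> ?E LY = {}" "?E LZ \<inter> ?E LX = {}" "?E LY \<inter> ?E LX = {}"
    using disj by simp_all
  have v: "act q ([LX] @ w @ [LX]) x \<in> flip q LX ` ?E LZ" if "x \<in> ?\<Omega> - flip q LX ` ?E LY" for x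
    using w out_x[OF that] by (simp add: act_append)
  have rv: "act q (rev ([LX] @ w @ [LX])) x \<in> flip q LX ` ?E LY" if "x \<in> ?\<Omega> - flip q LX ` ?E LZ" for x
    using rw out_x[OF that] by (simp add: act_append)
  show ?thesis
    unfolding ping_pong_def
  proof (intro conjI)
    have "inj (flip q LX)" by (rule inj_on_inverseI[of _ "flip q LX"]) simp
    thus "flip q LX ` ?E LZ \<inter> flip q LX ` ?E LY = {}"
      using E(1) by (simp flip: image_Int)
    show "?E LZ \<union> ?E LY \<union> flip q LX ` ?E LZ \<union> flip q LX ` ?E LY \<subseteq> ?\<Omega>"
      using Y sub[of LX] sub[of LY] sub[of LZ] by blast
    show "?E LZ \<inter> ?E LY = {}" by (rule E)
    show "?E LZ \<inter> flip q LX ` ?E LZ = {}" "?E LZ \<inter> flip q LX ` ?E LY = {}"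
      "?E LY \<inter> flip q LX ` ?E LZ = {}" "?E LY \<inter> flip q LX ` ?E LY = {}"
      using E(2,3) Y by blast+
  qed (use w rw v rv in blast)+
qed

text \<open>The root \<open>p\<close> lies in the orbit but in no branch, so it avoids the four
  attracting sets at every stage and witnesses non-commutation.\<close>

lemma commutator_words_noncommuting:
  assumes sep: "separated lo hi q" "p \<in> shell lo hi" and n: "0 < n"
    and "w = alternating LZ LY n" "commutator_words w ([LX] @ w @ [LX]) k = (a, b)"
  shows "act q (a @ b) p \<noteq> act q (b @ a) p"
proof -
  note pp = ping_pong_start[OF sep n]
  have p: "p \<notin> branch q p c" for c by (rule root_notin_branch[OF sep])
  have sub: "branch q p c \<subseteq> whole_orbit q p" for c by (auto simp: whole_orbit_def)
  have "flip q LX ` branch q p c \<subseteq> branch q p LX" if "c \<noteq> LX" for c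
    using flip_into_branch sub[of c] branch_disjoint[OF sep that] by blast
  from this[of LZ] this[of LY] have "p \<notin> flip q LX ` branch q p LZ" "p \<notin> flip q LX ` branch q p LY"
    using p[of LX] by auto
  hence "p \<in> whole_orbit q p - (branch q p LZ \<union> branch q p LY \<union>
      flip q LX ` branch q p LZ \<union> flip q LX ` branch q p LY)"
    using p[of LZ] p[of LY] by (simp add: whole_orbit_def)
  from ping_pong_commutator_words[OF pp this assms(5)[unfolded assms(4)]] ping_pong_noncommuting
  show ?thesis by blast
qed

section \<open>Linearization at a common fixed point\<close>

fun flip_deriv :: "complex3 \<Rightarrow> letter \<Rightarrow> complex3 \<Rightarrow> complex3" where
  "flip_deriv (x, y, z) LX (h, k, l) = (- h - y * l - z * k, k, l)"
| "flip_deriv (x, y, z) LY (h, k, l) = (h, - k - x * l - z * h, l)"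
| "flip_deriv (x, y, z) LZ (h, k, l) = (h, k, - l - x * k - y * h)"

text \<open>All factors are derivatives at the same point \<open>p\<close>; the chain rule turns the
  product into the derivative of the word when every flip fixes \<open>p\<close>.\<close>

primrec act_deriv :: "complex3 \<Rightarrow> letter list \<Rightarrow> complex3 \<Rightarrow> complex3" where
  "act_deriv p [] = id"
| "act_deriv p (c # w) = flip_deriv p c \<circ> act_deriv p w"

lemma flip_has_derivative: "(flip q c has_derivative flip_deriv p c) (at p)"
proof -
  obtain A B C x y z where [simp]: "q = (A, B, C)" "p = (x, y, z)" by (metis prod_cases3)
  have flips: "s_x A = (\<lambda>p. (- fst p - fst (snd p) * snd (snd p) + A, fst (snd p), snd (snd p)))"
    "s_y B = (\<lambda>p. (fst p, - fst (snd p) - fst p * snd (snd p) + B, snd (snd p)))"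
    "s_z C = (\<lambda>p. (fst p, fst (snd p), - snd (snd p) - fst p * fst (snd p) + C))"
    by (auto simp: s_x_def s_y_def s_z_def)
  show ?thesis
    by (cases c; simp add: flips)
       (rule has_derivative_eq_rhs, (rule derivative_eq_intros | rule refl)+,
        auto simp: fun_eq_iff algebra_simps)+
qed

lemma act_deriv_append: "act_deriv p (w @ v) h = act_deriv p w (act_deriv p v h)"
  by (induction w) auto

lemma flip_deriv_flip_deriv [simp]: "flip_deriv p c (flip_deriv p c h) = h"
  by (cases p; cases h; cases c) auto

lemma act_deriv_rev [simp]: "act_deriv p (rev w) (act_deriv p w h) = h"
  by (induction w arbitrary: h) (auto simp: act_deriv_append)

lemma bounded_linear_flip_deriv: "bounded_linear (flip_deriv p c)"
  using flip_has_derivative has_derivative_bounded_linear by blast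

lemma bounded_linear_act_deriv: "bounded_linear (act_deriv p w)"
  by (induction w) (auto simp: comp_def id_def intro: bounded_linear_compose[OF bounded_linear_flip_deriv])

lemma act_fixed: "(\<And>c. flip q c p = p) \<Longrightarrow> act q w p = p"
  by (induction w) auto

lemma act_has_derivative:
  assumes "\<And>c. flip q c p = p"
  shows "(act q w has_derivative act_deriv p w) (at p)"
proof (induction w)
  case (Cons c w)
  have "(flip q c has_derivative flip_deriv p c) (at (act q w p))"
    using flip_has_derivative[of q c p] act_fixed[of q p w] assms by simp
  from diff_chain_at[OF Cons.IH this] show ?case by (simp only: act.simps act_deriv.simps)
qed (auto simp: id_def)

lemma inner_mult_real: "(of_real a * v :: complex) \<bullet> w = a * (v \<bullet> w)"
  "v \<bullet> (of_real a * w :: complex) = a * (v \<bullet> w)"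
  by (auto simp: inner_complex_def algebra_simps)

text \<open>On the fibre \<open>x = a\<close> the derivatives of \<open>s_y\<close> and \<open>s_z\<close> act by affine maps; the common
  fixed point is \<open>(\<alpha> h, \<beta> h)\<close>, and the quadratic form \<open>Q\<close> measured from it is invariant and,
  since \<open>\<bar>a\<bar> < 2\<close>, positive definite.\<close>

lemma act_deriv_bounded:
  fixes a :: real and y z :: complex
  assumes a: "\<bar>a\<bar> < 2"
  obtains K where "0 < K"
    "\<And>w h. set w \<subseteq> {LY, LZ} \<Longrightarrow> norm (act_deriv (of_real a, y, z) w h) \<le> K * norm h"
proof -
  let ?p = "(of_real a, y, z) :: complex3"
  \<comment> \<open>Cramer's rule for \<open>2 * \<alpha> + of_real a * \<beta> + z = 0\<close> and
    \<open>2 * \<beta> + of_real a * \<alpha> + y = 0\<close>, with determinant 4 - a^2.\<close>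
  define \<alpha> where "\<alpha> = (of_real a * y - 2 * z) / (4 - of_real a ^ 2)"
  define \<beta> where "\<beta> = (of_real a * z - 2 * y) / (4 - of_real a ^ 2)"
  have "\<bar>a\<bar>\<^sup>2 < 2\<^sup>2" using a by (intro power_strict_mono) auto
  hence "4 - a\<^sup>2 \<noteq> 0" by simp
  moreover have "(4 - of_real a ^ 2 :: complex) = of_real (4 - a\<^sup>2)" by simp
  ultimately have ne: "(4 - of_real a ^ 2 :: complex) \<noteq> 0" by (metis of_real_eq_0_iff)
  have "\<alpha> * (4 - of_real a ^ 2) = of_real a * y - 2 * z" "\<beta> * (4 - of_real a ^ 2) = of_real a * z - 2 * y"
    using ne by (simp_all add: \<alpha>_def \<beta>_def)
  hence "(2 * \<alpha> + of_real a * \<beta> + z) * (4 - of_real a ^ 2) = 0" "(2 * \<beta> + of_real a * \<alpha> + y) * (4 - of_real a ^ 2) = 0"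
    by algebra+
  hence \<alpha>: "2 * \<alpha> + of_real a * \<beta> + z = 0" and \<beta>: "2 * \<beta> + of_real a * \<alpha> + y = 0"
    using ne by simp_all
  \<comment> \<open>Coordinates centred at the fixed point of the affine action. There the flips
    become v -> -v - a u and u -> -u - a v, which preserve \<open>Q\<close>.\<close>
  define v where "v = (\<lambda>h::complex3. fst (snd h) - \<alpha> * fst h)"
  define u where "u = (\<lambda>h::complex3. snd (snd h) - \<beta> * fst h)"
  define Q where "Q = (\<lambda>h. v h \<bullet> v h + u h \<bullet> u h + a * (v h \<bullet> u h))"
  have Q_flip: "Q (flip_deriv ?p c h) = Q h \<and> fst (flip_deriv ?p c h) = fst h"
    if "c \<in> {LY, LZ}" for c h
  proof -
    obtain b k l where h: "h = (b, k, l)" by (metis prod_cases3)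
    have "z = - 2 * \<alpha> - of_real a * \<beta>" "y = - 2 * \<beta> - of_real a * \<alpha>"
      using \<alpha> \<beta> by algebra+
    note yz = this
    have vu: "v (flip_deriv ?p LY h) = - v h - of_real a * u h" "u (flip_deriv ?p LY h) = u h"
      "u (flip_deriv ?p LZ h) = - u h - of_real a * v h" "v (flip_deriv ?p LZ h) = v h"
      by (simp_all add: h v_def u_def yz algebra_simps)
    have "Q (flip_deriv ?p LY h) = Q h" "Q (flip_deriv ?p LZ h) = Q h"
      unfolding Q_def vu
      by (simp_all add: inner_diff_left inner_diff_right inner_mult_real inner_commute algebra_simps)
    thus ?thesis using that by (auto simp: h)
  qed
  have Q: "Q (act_deriv ?p w h) = Q h \<and> fst (act_deriv ?p w h) = fst h" if "set w \<subseteq> {LY, LZ}" for w h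
    using that by (induction w) (use Q_flip in auto)
  define S where "S = (\<lambda>h. (norm (v h))\<^sup>2 + (norm (u h))\<^sup>2)"
  have mixed: "\<bar>a * (v h \<bullet> u h)\<bar> \<le> \<bar>a\<bar> / 2 * S h" for h
  proof -
    have "\<bar>v h \<bullet> u h\<bar> \<le> norm (v h) * norm (u h)" by (rule Cauchy_Schwarz_ineq2)
    also have "\<dots> \<le> S h / 2" using sum_squares_bound[of "norm (v h)" "norm (u h)"] by (simp add: S_def)
    finally have "\<bar>a\<bar> * \<bar>v h \<bullet> u h\<bar> \<le> \<bar>a\<bar> * (S h / 2)" by (rule mult_left_mono) simp
    thus ?thesis by (simp add: abs_mult)
  qed
  \<comment> \<open>The mixed term of \<open>Q\<close> is at most
    \<open>\<bar>a\<bar> / 2 * S h\<close>, so \<open>Q\<close> lies between \<open>m * S h\<close>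
    and \<open>2 * S h\<close>.\<close>
  define m where "m = 1 - \<bar>a\<bar> / 2"
  have m: "0 < m" using a by (simp add: m_def)
  have Q_S: "m * S h \<le> Q h" "Q h \<le> 2 * S h" for h
  proof -
    have S: "0 \<le> S h" by (simp add: S_def)
    have "Q h = S h + a * (v h \<bullet> u h)" by (simp add: Q_def S_def power2_norm_eq_inner)
    moreover have "\<bar>a\<bar> / 2 * S h \<le> 1 * S h" using a S by (intro mult_right_mono) auto
    ultimately show "m * S h \<le> Q h" "Q h \<le> 2 * S h"
      using mixed[of h] unfolding m_def by (simp_all add: algebra_simps abs_le_iff)
  qed
  define M where "M = 1 + norm \<alpha> + norm \<beta>"
  have M: "1 \<le> M" by (simp add: M_def)
  \<comment> \<open>From \<open>m * S h' \<le> Q h' = Q h \<le> 2 * S h \<le> 4 * (M * norm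
    h)\<^sup>2\<close>, where \<open>h'\<close> is the image of \<open>h\<close>, both centred
    coordinates of \<open>h'\<close> are at most \<open>\<kappa> * norm h\<close>.\<close>
  define \<kappa> where "\<kappa> = sqrt (4 / m) * M"
  have S_le: "S h \<le> 2 * (M * norm h)\<^sup>2" for h
  proof -
    have "norm (\<alpha> * fst h) \<le> norm \<alpha> * norm h" "norm (\<beta> * fst h) \<le> norm \<beta> * norm h"
      using norm_coordinates_le(1)[of h] by (auto simp: norm_mult intro!: mult_left_mono)
    hence "norm (v h) \<le> norm h + norm \<alpha> * norm h" "norm (u h) \<le> norm h + norm \<beta> * norm h"
      unfolding v_def u_def using norm_coordinates_le[of h]
      by (auto intro!: order_trans[OF norm_triangle_ineq4] add_mono)
    moreover have "norm h + norm \<alpha> * norm h \<le> M * norm h" "norm h + norm \<beta> * norm h \<le> M * norm h"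
      by (auto simp: M_def algebra_simps)
    ultimately have "norm (v h) \<le> M * norm h" "norm (u h) \<le> M * norm h" by linarith+
    hence "(norm (v h))\<^sup>2 \<le> (M * norm h)\<^sup>2" "(norm (u h))\<^sup>2 \<le> (M * norm h)\<^sup>2"
      by (auto intro: power_mono)
    thus ?thesis by (simp add: S_def)
  qed
  show ?thesis
  proof (rule that[of "M + 2 * \<kappa>"])
    show "0 < M + 2 * \<kappa>" using M m by (auto simp: \<kappa>_def intro!: add_pos_nonneg)
    fix w and h :: complex3 assume w: "set w \<subseteq> {LY, LZ}"
    define h' where "h' = act_deriv ?p w h"
    have "m * S h' \<le> 2 * (2 * (M * norm h)\<^sup>2)"
      using Q_S(1)[of h'] Q_S(2)[of h] S_le[of h] Q[OF w, of h] unfolding h'_def by linarith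
    hence "S h' \<le> 4 / m * (M * norm h)\<^sup>2" using m by (simp add: field_simps)
    also have "\<dots> = (\<kappa> * norm h)\<^sup>2" using m by (simp add: \<kappa>_def power_mult_distrib)
    finally have "S h' \<le> (\<kappa> * norm h)\<^sup>2" .
    moreover have "(norm (v h'))\<^sup>2 \<le> S h'" "(norm (u h'))\<^sup>2 \<le> S h'"
      by (simp_all add: S_def)
    ultimately have "(norm (v h'))\<^sup>2 \<le> (\<kappa> * norm h)\<^sup>2" "(norm (u h'))\<^sup>2 \<le> (\<kappa> * norm h)\<^sup>2"
      by linarith+
    moreover have "0 \<le> \<kappa> * norm h" using m M by (simp add: \<kappa>_def)
    ultimately have vu: "norm (v h') \<le> \<kappa> * norm h" "norm (u h') \<le> \<kappa> * norm h"
      by (auto intro: power2_le_imp_le)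
    have fst: "fst h' = fst h" using Q[OF w] by (simp add: h'_def)
    have "norm h' \<le> norm (fst h) + (norm (v h' + \<alpha> * fst h) + norm (u h' + \<beta> * fst h))"
      using norm_le_coordinates[of h'] fst by (simp add: v_def u_def)
    also have "\<dots> \<le> norm (fst h) + ((norm (v h') + norm \<alpha> * norm (fst h)) + (norm (u h') + norm \<beta> * norm (fst h)))"
      by (intro add_mono order_trans[OF norm_triangle_ineq]) (auto simp: norm_mult)
    also have "\<dots> = M * norm (fst h) + (norm (v h') + norm (u h'))"
      by (simp add: M_def algebra_simps)
    also have "\<dots> \<le> M * norm h + (\<kappa> * norm h + \<kappa> * norm h)"
      using vu norm_coordinates_le(1)[of h] M by (intro add_mono mult_left_mono) auto
    finally show "norm (act_deriv ?p w h) \<le> (M + 2 * \<kappa>) * norm h"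
      by (simp add: h'_def algebra_simps)
  qed
qed

section \<open>Recurrence of the powers of the linear part\<close>

lemma alternating_add: "alternating c d (m + n) = alternating c d m @ alternating c d n"
  by (induction m) auto

lemma set_alternating: "set (alternating c d n) \<subseteq> {c, d}"
  by (induction n) auto

text \<open>The powers of a linear map lie in a compact ball of operators, so two of them are
  arbitrarily close, and their quotient is a positive power close to the identity.\<close>

lemma act_deriv_recurrent:
  fixes a \<epsilon> :: real and y z :: complex
  assumes a: "\<bar>a\<bar> < 2" and \<epsilon>: "0 < \<epsilon>"
  shows "\<exists>n>0. \<forall>h. norm (act_deriv (of_real a, y, z) (alternating LZ LY n) h - h) \<le> \<epsilon> * norm h \<and>
    norm (act_deriv (of_real a, y, z) (rev (alternating LZ LY n)) h - h) \<le> \<epsilon> * norm h"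
proof -
  let ?p = "(of_real a, y, z) :: complex3"
  obtain K where K: "0 < K" "\<And>w h. set w \<subseteq> {LY, LZ} \<Longrightarrow> norm (act_deriv ?p w h) \<le> K * norm h"
    using act_deriv_bounded[OF a] by metis
  have alt: "set (alternating LZ LY n) \<subseteq> {LY, LZ}" "set (rev (alternating LZ LY n)) \<subseteq> {LY, LZ}" for n
    using set_alternating[of LZ LY n] by auto
  define f where "f = (\<lambda>n. Blinfun (act_deriv ?p (alternating LZ LY n)))"
  have f: "blinfun_apply (f n) = act_deriv ?p (alternating LZ LY n)" for n
    unfolding f_def by (rule bounded_linear_Blinfun_apply[OF bounded_linear_act_deriv])
  have "norm (f n) \<le> K" for n
    using K alt by (intro norm_blinfun_bound) (auto simp: f)
  hence "\<forall>n. f n \<in> cball 0 K" by (simp add: dist_norm)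
  then obtain l r where r: "strict_mono (r :: nat \<Rightarrow> nat)" "(f \<circ> r) \<longlonglongrightarrow> l"
    using compact_cball[of 0 K] unfolding compact_def by meson
  \<comment> \<open>The forward estimate costs a factor \<open>K\<close>, the backward one
    \<open>K * K\<close>; the sum covers both.\<close>
  define \<epsilon>' where "\<epsilon>' = \<epsilon> / (K + K * K)"
  have \<epsilon>': "0 < \<epsilon>'" using \<epsilon> K(1) by (simp add: \<epsilon>'_def add_pos_pos)
  have "Cauchy (f \<circ> r)" using r(2) LIMSEQ_imp_Cauchy by blast
  then obtain N where "\<And>i j. i \<ge> N \<Longrightarrow> j \<ge> N \<Longrightarrow> dist ((f \<circ> r) i) ((f \<circ> r) j) < \<epsilon>'"
    using \<epsilon>' unfolding Cauchy_def by blast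
  hence close: "norm (f (r (Suc N)) - f (r N)) < \<epsilon>'" by (simp add: dist_norm)
  define m n where "m = r N" and "n = r (Suc N) - r N"
  have n: "0 < n" "r (Suc N) = m + n"
    using strict_monoD[OF r(1), of N "Suc N"] by (auto simp: m_def n_def)
  let ?w = "alternating LZ LY n" and ?u = "alternating LZ LY m"
  have fwd: "norm (act_deriv ?p ?w h - h) \<le> K * \<epsilon>' * norm h" for h
  proof -
    have "norm (f (m + n) h - f m h) \<le> norm (f (m + n) - f m) * norm h"
      using norm_blinfun[of "f (m + n) - f m" h] by (simp add: blinfun.diff_left)
    also have "\<dots> \<le> \<epsilon>' * norm h"
      using close n(2) by (intro mult_right_mono) (auto simp: m_def)
    finally have d: "norm (f (m + n) h - f m h) \<le> \<epsilon>' * norm h" .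
    \<comment> \<open>With T the derivative of the word [LZ, LY], this is T^n - 1 = T^(-m) (T^(m+n)
      - T^m).\<close>
    have "act_deriv ?p ?w h - h = act_deriv ?p (rev ?u) (f (m + n) h - f m h)"
      using bounded_linear_act_deriv[of ?p "rev ?u"]
      by (simp add: f alternating_add act_deriv_append linear_diff bounded_linear.linear)
    also have "norm \<dots> \<le> K * norm (f (m + n) h - f m h)" by (rule K(2)[OF alt(2)])
    also have "\<dots> \<le> K * (\<epsilon>' * norm h)" using d K(1) by (intro mult_left_mono) auto
    finally show ?thesis by (simp add: mult.assoc)
  qed
  have bwd: "norm (act_deriv ?p (rev ?w) h - h) \<le> K * K * \<epsilon>' * norm h" for h
  proof -
    \<comment> \<open>Up to sign, T^(-n) - 1 is T^(-n) (T^n - 1).\<close>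
    have "norm (act_deriv ?p (rev ?w) h - h) = norm (act_deriv ?p (rev ?w) (act_deriv ?p ?w h - h))"
      using bounded_linear_act_deriv[of ?p "rev ?w"]
      by (simp add: linear_diff bounded_linear.linear norm_minus_commute)
    also have "\<dots> \<le> K * norm (act_deriv ?p ?w h - h)" by (rule K(2)[OF alt(2)])
    also have "\<dots> \<le> K * (K * \<epsilon>' * norm h)" using fwd K(1) by (intro mult_left_mono) auto
    finally show ?thesis by (simp add: mult.assoc)
  qed
  have "K * \<epsilon>' \<le> \<epsilon>" "K * K * \<epsilon>' \<le> \<epsilon>"
    using K(1) \<epsilon> pos_divide_le_eq[of "K + K * K"]
    by (simp_all add: \<epsilon>'_def add_pos_pos algebra_simps)
  hence "K * \<epsilon>' * norm h \<le> \<epsilon> * norm h" "K * K * \<epsilon>' * norm h \<le> \<epsilon> * norm h" for h :: complex3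
    by (auto intro: mult_right_mono)
  thus ?thesis using n(1) order_trans[OF fwd] order_trans[OF bwd]
    by (intro exI[of _ n] conjI allI) simp_all
qed

text \<open>Conjugation by a flip costs the square of a bound for its derivative. This
  \<open>M\<close> is independent of \<open>w\<close>, so it can be fixed before the recurrent power
  is chosen.\<close>

lemma act_deriv_conjugate:
  "\<exists>M>0. \<forall>w \<epsilon>. 0 \<le> \<epsilon> \<longrightarrow> (\<forall>h. norm (act_deriv p w h - h) \<le> \<epsilon> * norm h) \<longrightarrow>
    (\<forall>h. norm (act_deriv p ([c] @ w @ [c]) h - h) \<le> M * \<epsilon> * norm h)"
proof -
  obtain L where L: "0 < L" "\<And>h. norm (flip_deriv p c h) \<le> norm h * L"
    using bounded_linear.pos_bounded[OF bounded_linear_flip_deriv] by metis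
  show ?thesis
  proof (intro exI[of _ "L * L"] conjI allI impI)
    fix w \<epsilon> h
    assume \<epsilon>: "0 \<le> \<epsilon>" and w: "\<forall>h. norm (act_deriv p w h - h) \<le> \<epsilon> * norm h"
    let ?h = "flip_deriv p c h"
    have "act_deriv p ([c] @ w @ [c]) h - h = flip_deriv p c (act_deriv p w ?h - ?h)"
      using bounded_linear_flip_deriv[of p c]
      by (simp add: act_deriv_append linear_diff bounded_linear.linear)
    also have "norm \<dots> \<le> norm (act_deriv p w ?h - ?h) * L" by (rule L(2))
    also have "\<dots> \<le> \<epsilon> * norm ?h * L" by (rule mult_right_mono[OF w[rule_format]]) (use L(1) in simp)
    also have "\<dots> \<le> \<epsilon> * (norm h * L) * L" using L \<epsilon> by (intro mult_right_mono mult_left_mono) auto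
    finally show "norm (act_deriv p ([c] @ w @ [c]) h - h) \<le> L * L * \<epsilon> * norm h"
      by (simp add: mult_ac)
  qed (use L(1) in simp)
qed

text \<open>The linear part and the remainder contribute \<open>\<epsilon> * norm (x - p)\<close>
  each. The bound is relative to the distance from \<open>p\<close>, so on small balls the
  displacement is a small fraction of the radius.\<close>

lemma displacement_near_fixed_point:
  assumes fixed: "\<And>c. flip q c p = p"
    and near: "\<And>h. norm (act_deriv p w h - h) \<le> \<epsilon> * norm h" and \<epsilon>: "0 < \<epsilon>"
  shows "\<exists>d>0. \<forall>x. norm (x - p) < d \<longrightarrow> norm (act q w x - x) \<le> 2 * \<epsilon> * norm (x - p)"
proof -
  have "\<exists>d>0. \<forall>x. norm (x - p) < d \<longrightarrow>
      norm (act q w x - act q w p - act_deriv p w (x - p)) \<le> \<epsilon> * norm (x - p)"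
    using act_has_derivative[OF fixed, of w] \<epsilon> unfolding has_derivative_at_alt by blast
  then obtain d where d: "0 < d" "\<And>x. norm (x - p) < d \<Longrightarrow>
      norm (act q w x - act q w p - act_deriv p w (x - p)) \<le> \<epsilon> * norm (x - p)"
    by blast
  have "norm (act q w x - x) \<le> 2 * \<epsilon> * norm (x - p)" if "norm (x - p) < d" for x
  proof -
    have "act q w x - x = (act q w x - act q w p - act_deriv p w (x - p)) +
        (act_deriv p w (x - p) - (x - p))"
      by (simp add: act_fixed[OF fixed])
    also have "norm \<dots> \<le> \<epsilon> * norm (x - p) + \<epsilon> * norm (x - p)"
      by (intro norm_triangle_mono d near that)
    finally show ?thesis by simp
  qed
  thus ?thesis using d(1) by blast
qed

section \<open>Perturbing the parameters\<close>

lemma continuous_on_flip: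
  assumes "continuous_on S f" "continuous_on S g"
  shows "continuous_on S (\<lambda>x. flip (f x) c (g x))"
proof -
  have "flip q LX p = (- fst p - fst (snd p) * snd (snd p) + fst q, fst (snd p), snd (snd p))"
    "flip q LY p = (fst p, - fst (snd p) - fst p * snd (snd p) + fst (snd q), snd (snd p))"
    "flip q LZ p = (fst p, fst (snd p), - snd (snd p) - fst p * fst (snd p) + snd (snd q))" for q p
    by (cases q; cases p; simp add: s_x_def s_y_def s_z_def)+
  thus ?thesis by (cases c) (auto intro!: continuous_intros assms)
qed

lemma continuous_on_act: "continuous_on S (\<lambda>x. act (fst x) w (snd x))"
  by (induction w) (auto intro!: continuous_on_flip continuous_intros)

text \<open>By compactness of the closed ball the action changes by at most
  \<open>\<delta>' - \<delta>\<close> on the whole ball when the parameters move little.\<close>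

lemma displacement_perturbation:
  assumes base: "\<And>x. x \<in> cball p r \<Longrightarrow> norm (act q0 w x - x) \<le> \<delta>" and "\<delta> < \<delta>'"
  shows "\<exists>N. open N \<and> q0 \<in> N \<and> (\<forall>q\<in>N. displacement_le q w p r \<delta>')"
proof -
  define fx where "fx = (\<lambda>x. act (fst x) w (snd x))"
  have "continuous_on (UNIV \<times> cball p r) fx"
    unfolding fx_def by (rule continuous_on_act)
  then obtain N where N: "q0 \<in> N" "open N"
    "\<forall>q\<in>N \<inter> UNIV. \<forall>x\<in>cball p r. dist (fx (q, x)) (fx (q0, x)) \<le> \<delta>' - \<delta>"
    using assms(2) by (elim continuous_on_prod_compactE[OF _ compact_cball, of UNIV p r fx q0 "\<delta>' - \<delta>"]) auto
  have "norm (act q w x - x) \<le> \<delta>'" if "q \<in> N" "x \<in> ball p r" for q x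
  proof -
    have "norm (act q w x - act q0 w x) \<le> \<delta>' - \<delta>"
      using N(3) that by (simp add: fx_def dist_norm)
    moreover have "norm (act q0 w x - x) \<le> \<delta>" using base that(2) by simp
    ultimately show ?thesis
      using norm_triangle_ineq[of "act q w x - act q0 w x" "act q0 w x - x"] by simp
  qed
  thus ?thesis using N(1,2) unfolding displacement_le_def by blast
qed

text \<open>No implicit function theorem, so that singular points are covered: if \<open>Z\<^sup>2 + b Z + c\<close> is
  small at \<open>z\<close> then one of its two roots is close to \<open>z\<close>.\<close>

lemma surface_point_nearby:
  assumes "(x, y, z) \<in> surface A0 B0 C0 D0" "0 < \<epsilon>"
  shows "\<exists>N. open N \<and> (A0, B0, C0, D0) \<in> N \<and>
    (\<forall>A B C D. (A, B, C, D) \<in> N \<longrightarrow> (\<exists>z'. norm (z' - z) < \<epsilon> \<and> (x, y, z') \<in> surface A B C D))"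
proof -
  \<comment> \<open>The defect of the surface equation at the fixed point \<open>(x, y, z)\<close>,
    as a function of the parameters.\<close>
  define e where "e = (\<lambda>q::complex \<times> complex \<times> complex \<times> complex. x\<^sup>2 + y\<^sup>2 + z\<^sup>2 + x * y * z -
    (fst q * x + fst (snd q) * y + fst (snd (snd q)) * z + snd (snd (snd q))))"
  have "open {q. norm (e q) < \<epsilon>\<^sup>2}"
    unfolding e_def by (intro open_Collect_less continuous_intros)
  moreover have "e (A0, B0, C0, D0) = 0"
    using assms(1) by (simp add: e_def surface_def algebra_simps)
  moreover have "\<exists>z'. norm (z' - z) < \<epsilon> \<and> (x, y, z') \<in> surface A B C D"
    if small: "norm (e (A, B, C, D)) < \<epsilon>\<^sup>2" for A B C D
  proof -
    define b c where "b = x * y - C" and "c = x\<^sup>2 + y\<^sup>2 - A * x - B * y - D"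
    define s where "s = csqrt (b\<^sup>2 - 4 * c)"
    have s: "s\<^sup>2 = b\<^sup>2 - 4 * c" by (simp add: s_def)
    define z1 z2 where "z1 = (s - b) / 2" and "z2 = (- s - b) / 2"
    have fac: "(Z - z1) * (Z - z2) = Z\<^sup>2 + b * Z + c" for Z
      using s by (simp add: z1_def z2_def field_simps power2_eq_square)
    have "z1\<^sup>2 + b * z1 + c = 0" "z2\<^sup>2 + b * z2 + c = 0"
      using fac[of z1] fac[of z2] by simp_all
    hence surf: "(x, y, z1) \<in> surface A B C D" "(x, y, z2) \<in> surface A B C D"
      by (simp_all add: surface_def b_def c_def algebra_simps add_eq_0_iff)
    have "e (A, B, C, D) = z\<^sup>2 + b * z + c"
      by (simp add: e_def b_def c_def algebra_simps)
    hence "e (A, B, C, D) = (z - z1) * (z - z2)"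
      by (simp only: fac)
    hence "norm (z1 - z) * norm (z2 - z) < \<epsilon> * \<epsilon>"
      using small by (simp add: norm_mult norm_minus_commute power2_eq_square)
    hence "norm (z1 - z) < \<epsilon> \<or> norm (z2 - z) < \<epsilon>"
      using assms(2) mult_mono[of \<epsilon> "norm (z1 - z)" \<epsilon> "norm (z2 - z)"] by force
    thus ?thesis using surf by blast
  qed
  ultimately show ?thesis
    using assms(2) by (intro exI[of _ "{q. norm (e q) < \<epsilon>\<^sup>2}"]) auto
qed

section \<open>Coexistence at one parameter and near a given one\<close>

definition coexistence :: "complex \<Rightarrow> complex \<Rightarrow> complex \<Rightarrow> complex \<Rightarrow> bool" where
  "coexistence A B C D \<longleftrightarrow> (\<exists>U V.
        open_in_surface A B C D U \<and> open_in_surface A B C D V \<and>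
        U \<noteq> {} \<and> V \<noteq> {} \<and> U \<inter> V = {} \<and>
        locally_nondiscrete_on A B C D U \<and> U \<subseteq> \<N> A B C D \<and>
        (\<forall>p\<in>V. \<forall>W. open_in_surface A B C D W \<and> p \<in> W \<longrightarrow> locally_discrete_on A B C D W) \<and>
        V \<subseteq> \<D> A B C D \<and>
        properly_discontinuous_on A B C D V \<and>
        (\<forall>\<delta>>0. \<exists>\<gamma>\<^sub>1\<in>\<G> A B C D. \<exists>\<gamma>\<^sub>2\<in>\<G> A B C D.
          \<gamma>\<^sub>1 \<otimes>\<^bsub>BS A B C D\<^esub> \<gamma>\<^sub>2 \<noteq> \<gamma>\<^sub>2 \<otimes>\<^bsub>BS A B C D\<^esub> \<gamma>\<^sub>1 \<and>
          (SUP q\<in>U. ereal (norm (\<gamma>\<^sub>1 q - q))) < ereal \<delta> \<and>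
          (SUP q\<in>U. ereal (norm (\<gamma>\<^sub>2 q - q))) < ereal \<delta>))"

text \<open>The ball of radius \<open>r / 2\<close> about \<open>p0\<close> remains in the domain of
  every commutator estimate. The iterated commutators give both the sequence tending to the identity
  and the non-commuting pairs.\<close>

lemma coexistence_if_near_identity:
  assumes sep: "separated lo hi (A, B, C)"
    and p1: "p1 \<in> surface A B C D \<inter> shell lo hi"
    and n: "0 < n" and w: "w = alternating LZ LY n" "v = [LX] @ w @ [LX]"
    and r: "0 < r" "norm (fst p0) + r \<le> 2"
    and start: "\<And>u. u \<in> {w, rev w, v, rev v} \<Longrightarrow> displacement_le (A, B, C) u p0 r (r / 128)"
    and p2: "p2 \<in> surface A B C D \<inter> ball p0 (r / 2)"
  shows "coexistence A B C D"
proof -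
  let ?S = "surface A B C D"
  define U V where "U = ?S \<inter> ball p0 (r / 2)" and "V = ?S \<inter> shell lo hi"
  define a b where "a = (\<lambda>k. fst (commutator_words w v k))" and "b = (\<lambda>k. snd (commutator_words w v k))"
  have ab: "commutator_words w v k = (a k, b k)" for k by (simp add: a_def b_def)
  have even_ab: "even (length (a k))" "even (length (b k))" for k
    using even_length_commutator_words[OF _ _ ab, of k] w even_length_alternating by simp_all
  have G: "word_map A B C D (a k) \<in> \<G> A B C D" "word_map A B C D (b k) \<in> \<G> A B C D" for k
    by (rule even_word_map_in_\<G>, rule even_ab)+
  have small: "norm (word_map A B C D u x - x) \<le> r / 128 / 2 ^ k"
    if "u \<in> {a k, b k}" "x \<in> U" for u x k
  proof -
    have "displacement_le (A, B, C) u p0 (r / 2 + r / 2 / 2 ^ k) (r / 128 / 2 ^ k)"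
      by (rule commutator_words_displacement[OF r(1) _ _ _ _ ab]) (use start that(1) in auto)
    moreover have "dist p0 x < r / 2 + r / 2 / 2 ^ k"
    proof -
      have "dist p0 x < r / 2" "0 < r / 2 / 2 ^ k" using that(2) r(1) by (simp_all add: U_def)
      thus ?thesis by linarith
    qed
    ultimately show ?thesis using displacement_leD that(2) by (simp add: U_def)
  qed
  have noncomm: "word_map A B C D (a k) \<otimes>\<^bsub>BS A B C D\<^esub> word_map A B C D (b k) \<noteq>
      word_map A B C D (b k) \<otimes>\<^bsub>BS A B C D\<^esub> word_map A B C D (a k)" for k
  proof
    assume "word_map A B C D (a k) \<otimes>\<^bsub>BS A B C D\<^esub> word_map A B C D (b k) =
      word_map A B C D (b k) \<otimes>\<^bsub>BS A B C D\<^esub> word_map A B C D (a k)"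
    \<comment> \<open>Evaluation at \<open>p1\<close>, a surface point, where
      \<open>word_map\<close> agrees with \<open>act\<close>.\<close>
    hence "word_map A B C D (a k @ b k) p1 = word_map A B C D (b k @ a k) p1"
      by (simp only: word_map_mult)
    thus False
      using commutator_words_noncommuting[OF sep _ n w(1) ab[unfolded w(2)], of p1] p1 by simp
  qed
  have nontrivial: "word_map A B C D (a k) \<noteq> \<one>\<^bsub>BS A B C D\<^esub>" for k
  proof
    interpret group "BS A B C D" by (rule group_BijGroup)
    assume "word_map A B C D (a k) = \<one>\<^bsub>BS A B C D\<^esub>"
    thus False using noncomm[of k] word_map_carrier[of A B C "b k" D] by simp
  qed
  have tiny: "\<exists>k. \<forall>m\<ge>k. r / 128 / 2 ^ m < \<delta>" if "0 < \<delta>" for \<delta> :: real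
  proof -
    have "(\<lambda>m. r / 128 * (1 / 2) ^ m) \<longlonglongrightarrow> r / 128 * 0"
      by (intro tendsto_mult tendsto_const LIMSEQ_power_zero) simp
    hence "\<forall>\<^sub>F m in sequentially. r / 128 * (1 / 2) ^ m < \<delta>"
      using that by (intro order_tendstoD(2)) auto
    thus ?thesis by (simp add: eventually_sequentially power_divide)
  qed
  have nondiscrete: "locally_nondiscrete_on A B C D U"
    unfolding locally_nondiscrete_on_def
  proof (intro exI[of _ "\<lambda>k. word_map A B C D (a k)"] conjI allI impI)
    show "word_map A B C D (a k) \<in> \<G> A B C D - {\<one>\<^bsub>BS A B C D\<^esub>}" for k
      using G(1) nontrivial by blast
    fix K assume K: "compact K \<and> K \<subseteq> U"
    have "\<exists>N. \<forall>k\<ge>N. \<forall>x\<in>K. dist (word_map A B C D (a k) x) x < e" if "0 < e" for e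
      using tiny[OF that] small[OF insertI1] K unfolding dist_norm
      by (meson order_le_less_trans subsetD)
    thus "uniform_limit K (\<lambda>k. word_map A B C D (a k)) (\<lambda>p. p) sequentially"
      unfolding uniform_limit_sequentially_iff by blast
  qed
  have openU: "open_in_surface A B C D U"
    unfolding U_def by (intro openin_open_Int open_ball)
  have openV: "open_in_surface A B C D V"
    unfolding V_def by (intro openin_open_Int open_shell)
  have disjoint: "U \<inter> V = {}"
  proof -
    have "x \<notin> shell lo hi" if "x \<in> ball p0 (r / 2)" for x
    proof -
      \<comment> \<open>The first coordinate separates the sets: its norm is below 2 on the ball and
        above \<open>lo > 2\<close> on the shell.\<close>
      have "norm (fst x - fst p0) \<le> dist p0 x"
        using norm_coordinates_le(1)[of "x - p0"] by (simp add: dist_norm norm_minus_commute)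
      hence "norm (fst x) < 2"
        using that r norm_triangle_sub[of "fst x" "fst p0"] by simp
      moreover have "2 < lo" using sep by simp
      ultimately show ?thesis by (cases x) (auto simp: shell_def)
    qed
    thus ?thesis by (auto simp: U_def V_def)
  qed
  have nonempty: "U \<noteq> {}" "V \<noteq> {}" using p1 p2 by (auto simp: U_def V_def)
  have U_N: "U \<subseteq> \<N> A B C D"
  proof
    fix x assume "x \<in> U"
    moreover from this have "x \<in> ?S" by (simp add: U_def)
    ultimately show "x \<in> \<N> A B C D"
      unfolding \<N>_def using openU nondiscrete by blast
  qed
  have discrete: "locally_discrete_on A B C D W" if "p \<in> V" "p \<in> W" for p W
    by (rule locally_discrete_at_shell[OF sep]) (use that in \<open>simp_all add: V_def\<close>)
  have V_D: "V \<subseteq> \<D> A B C D"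
  proof
    fix x assume "x \<in> V"
    moreover from this have "x \<in> ?S" by (simp add: V_def)
    ultimately show "x \<in> \<D> A B C D"
      unfolding \<D>_def \<N>_def using discrete by blast
  qed
  have V_pd: "properly_discontinuous_on A B C D V"
    unfolding V_def by (rule properly_discontinuous_on_shell[OF sep])
  have pairs: "\<exists>\<gamma>\<^sub>1\<in>\<G> A B C D. \<exists>\<gamma>\<^sub>2\<in>\<G> A B C D.
          \<gamma>\<^sub>1 \<otimes>\<^bsub>BS A B C D\<^esub> \<gamma>\<^sub>2 \<noteq> \<gamma>\<^sub>2 \<otimes>\<^bsub>BS A B C D\<^esub> \<gamma>\<^sub>1 \<and>
          (SUP q\<in>U. ereal (norm (\<gamma>\<^sub>1 q - q))) < ereal \<delta> \<and>
          (SUP q\<in>U. ereal (norm (\<gamma>\<^sub>2 q - q))) < ereal \<delta>" if "0 < \<delta>" for \<delta>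
  proof -
    obtain k where k: "r / 128 / 2 ^ k < \<delta>" using tiny[OF \<open>0 < \<delta>\<close>] by blast
    have "(SUP x\<in>U. ereal (norm (word_map A B C D u x - x))) < ereal \<delta>" if "u \<in> {a k, b k}" for u
    proof (rule order_le_less_trans)
      \<comment> \<open>The supremum is bounded only weakly; strictness comes from the choice of
        \<open>k\<close>.\<close>
      show "(SUP x\<in>U. ereal (norm (word_map A B C D u x - x))) \<le> ereal (r / 128 / 2 ^ k)"
        by (rule SUP_least) (use small[OF that] in simp)
    qed (use k in simp)
    thus ?thesis using G[of k] noncomm[of k] by blast
  qed
  show ?thesis
    unfolding coexistence_def
    by (intro exI[of _ U] exI[of _ V] conjI ballI allI impI)
       (erule conjE | rule openU openV nonempty disjoint nondiscrete U_N discrete V_D V_pd pairs | assumption)+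
qed

text \<open>The fixed point supplies \<open>U\<close>, the diagonal point supplies \<open>V\<close>.
  The choices are made in the order \<open>M\<close>, \<open>\<epsilon>\<close>, \<open>n\<close>,
  \<open>r\<close>; the word is then fixed, so finitely many open conditions on the parameters
  remain.\<close>

lemma coexistence_near:
  fixes a :: real and t :: complex
  assumes p0: "(of_real a, y0, z0) \<in> surface A0 B0 C0 D0" "\<bar>a\<bar> < 2"
    "\<And>c. flip (A0, B0, C0) c (of_real a, y0, z0) = (of_real a, y0, z0)"
    and t: "(t, t, t) \<in> surface A0 B0 C0 D0" "2 < norm t"
    "norm A0 < (norm t)\<^sup>2 - 2 * norm t" "norm B0 < (norm t)\<^sup>2 - 2 * norm t"
    "norm C0 < (norm t)\<^sup>2 - 2 * norm t"
  shows "\<exists>N. open N \<and> (A0, B0, C0, D0) \<in> N \<and>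
    (\<forall>A B C D. (A, B, C, D) \<in> N \<longrightarrow> coexistence A B C D)"
proof -
  let ?p0 = "(of_real a, y0, z0) :: complex3" and ?q0 = "(A0, B0, C0)"
  define T where "T = norm t"
  \<comment> \<open>The slack in the three strict bounds; \<open>d\<close> spends at most half of it
    in thickening the sphere of radius \<open>T\<close> to a shell.\<close>
  define \<eta> where "\<eta> = T\<^sup>2 - 2 * T - Max {norm A0, norm B0, norm C0}"
  have \<eta>: "0 < \<eta>" "norm A0 \<le> T\<^sup>2 - 2 * T - \<eta>" "norm B0 \<le> T\<^sup>2 - 2 * T - \<eta>" "norm C0 \<le> T\<^sup>2 - 2 * T - \<eta>"
    using t by (auto simp: \<eta>_def T_def)
  define d where "d = min ((T - 2) / 2) (\<eta> / (4 * (T + 1)))"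
  have T: "2 < T" using t by (simp add: T_def)
  have "d \<le> (T - 2) / 2" unfolding d_def by (rule min.cobounded1)
  moreover have "0 < d" using T \<eta>(1) by (simp add: d_def)
  ultimately have d: "0 < d" "d < T - 2" using T by simp_all
  have d_le: "d * (4 * (T + 1)) \<le> \<eta>"
    using T by (subst pos_le_divide_eq[symmetric]) (auto simp: d_def)
  have gap: "T\<^sup>2 - 2 * T - \<eta> < (T - d)\<^sup>2 - 2 * (T + d)"
  proof -
    have "(T - d)\<^sup>2 - 2 * (T + d) = T\<^sup>2 - 2 * T - d * (4 * (T + 1)) / 2 + d\<^sup>2"
      by (simp add: power2_eq_square algebra_simps)
    thus ?thesis using d_le \<eta>(1) zero_le_power2[of d] by linarith
  qed
  have sep0: "separated (T - d) (T + d) ?q0"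
    using d \<eta> gap by simp
  define N1 where "N1 = {q::complex \<times> complex \<times> complex \<times> complex.
     norm (fst q) < (T - d)\<^sup>2 - 2 * (T + d) \<and> norm (fst (snd q)) < (T - d)\<^sup>2 - 2 * (T + d) \<and>
     norm (fst (snd (snd q))) < (T - d)\<^sup>2 - 2 * (T + d)}"
  have N1: "open N1" "(A0, B0, C0, D0) \<in> N1"
    "\<And>A B C D. (A, B, C, D) \<in> N1 \<Longrightarrow> separated (T - d) (T + d) (A, B, C)"
    using sep0 d unfolding N1_def
    by (auto intro!: open_Collect_conj open_Collect_less continuous_intros)
  obtain N2 where N2: "open N2" "(A0, B0, C0, D0) \<in> N2"
    "\<And>A B C D. (A, B, C, D) \<in> N2 \<Longrightarrow> \<exists>z'. norm (z' - t) < d \<and> (t, t, z') \<in> surface A B C D"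
    using surface_point_nearby[OF t(1) d(1)] by blast
  have shell: "(t, t, z') \<in> shell (T - d) (T + d)" if "norm (z' - t) < d" for z'
    using that d(1) norm_triangle_sub[of z' t] norm_triangle_sub[of t z']
    by (simp add: shell_def T_def norm_minus_commute)
  obtain M where M: "0 < M"
    "\<forall>w \<epsilon>. 0 \<le> \<epsilon> \<longrightarrow> (\<forall>h. norm (act_deriv ?p0 w h - h) \<le> \<epsilon> * norm h) \<longrightarrow>
      (\<forall>h. norm (act_deriv ?p0 ([LX] @ w @ [LX]) h - h) \<le> M * \<epsilon> * norm h)"
    using act_deriv_conjugate[of ?p0 LX] by (elim exE conjE)
  \<comment> \<open>Both \<open>\<epsilon>\<close> and \<open>M * \<epsilon>\<close> are at most
    1/512. Linearization doubles this to 1/256, which leaves room below 1/128 for the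
    perturbation.\<close>
  define \<epsilon> where "\<epsilon> = 1 / 512 / (1 + M)"
  have \<epsilon>: "0 < \<epsilon>" "\<epsilon> \<le> 1 / 512" "M * \<epsilon> \<le> 1 / 512"
    using M(1) by (auto simp: \<epsilon>_def field_simps)
  obtain n where n: "0 < n"
    "\<And>h. norm (act_deriv ?p0 (alternating LZ LY n) h - h) \<le> \<epsilon> * norm h"
    "\<And>h. norm (act_deriv ?p0 (rev (alternating LZ LY n)) h - h) \<le> \<epsilon> * norm h"
    using act_deriv_recurrent[OF p0(2) \<epsilon>(1)] by blast
  define w v where "w = alternating LZ LY n" and "v = [LX] @ w @ [LX]"
  let ?W = "{w, rev w, v, rev v}"
  have near: "norm (act_deriv ?p0 u h - h) \<le> 1 / 512 * norm h" if "u \<in> ?W" for u h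
  proof -
    have "norm (act_deriv ?p0 v h - h) \<le> M * \<epsilon> * norm h"
      "norm (act_deriv ?p0 (rev v) h - h) \<le> M * \<epsilon> * norm h"
    proof -
      have rev_v: "rev v = [LX] @ rev w @ [LX]" by (simp add: v_def)
      show "norm (act_deriv ?p0 v h - h) \<le> M * \<epsilon> * norm h"
        unfolding v_def w_def by (rule M(2)[rule_format, OF _ n(2)]) (use \<epsilon>(1) in simp)
      show "norm (act_deriv ?p0 (rev v) h - h) \<le> M * \<epsilon> * norm h"
        unfolding rev_v w_def by (rule M(2)[rule_format, OF _ n(3)]) (use \<epsilon>(1) in simp)
    qed
    hence "norm (act_deriv ?p0 u h - h) \<le> \<epsilon> * norm h \<or> norm (act_deriv ?p0 u h - h) \<le> M * \<epsilon> * norm h"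
      using that n(2,3)[of h] by (auto simp: w_def)
    moreover have "\<epsilon> * norm h \<le> 1 / 512 * norm h" "M * \<epsilon> * norm h \<le> 1 / 512 * norm h"
      by (rule mult_right_mono[OF \<epsilon>(2) norm_ge_zero], rule mult_right_mono[OF \<epsilon>(3) norm_ge_zero])
    ultimately show ?thesis by linarith
  qed
  have "\<forall>u\<in>?W. \<exists>d>0. \<forall>x. norm (x - ?p0) < d \<longrightarrow> norm (act ?q0 u x - x) \<le> 2 * (1 / 512) * norm (x - ?p0)"
    by (intro ballI displacement_near_fixed_point[OF p0(3)] near) auto
  from bchoice[OF this] obtain \<rho> where \<rho>0: "\<forall>u\<in>?W. 0 < \<rho> u \<and>
    (\<forall>x. norm (x - ?p0) < \<rho> u \<longrightarrow> norm (act ?q0 u x - x) \<le> 2 * (1 / 512) * norm (x - ?p0))"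
    by (elim exE)
  have \<rho>: "0 < \<rho> u" "norm (x - ?p0) < \<rho> u \<Longrightarrow> norm (act ?q0 u x - x) \<le> 2 * (1 / 512) * norm (x - ?p0)"
    if "u \<in> ?W" for u x
    using bspec[OF \<rho>0 that] by blast+
  \<comment> \<open>Halving puts the closed ball strictly inside all four linearization
    balls.\<close>
  define r where "r = min (Min (\<rho> ` ?W)) (2 - \<bar>a\<bar>) / 2"
  have r: "0 < r" "\<bar>a\<bar> + r \<le> 2" "\<And>u. u \<in> ?W \<Longrightarrow> r < \<rho> u"
  proof -
    have m: "0 < Min (\<rho> ` ?W)" using \<rho>(1) by (subst Min_gr_iff) auto
    have le: "r \<le> Min (\<rho> ` ?W) / 2" "r \<le> (2 - \<bar>a\<bar>) / 2"
      unfolding r_def by (rule divide_right_mono[OF min.cobounded1], simp, rule divide_right_mono[OF min.cobounded2], simp)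
    show "0 < r" unfolding r_def using m p0(2) by simp
    show "\<bar>a\<bar> + r \<le> 2" using le(2) p0(2) by simp
    fix u assume "u \<in> ?W"
    hence "Min (\<rho> ` ?W) \<le> \<rho> u" by (intro Min_le) auto
    thus "r < \<rho> u" using le(1) m by linarith
  qed
  have "\<exists>N. open N \<and> ?q0 \<in> N \<and> (\<forall>q\<in>N. displacement_le q u ?p0 r (r / 128))" if u: "u \<in> ?W" for u
  proof (rule displacement_perturbation)
    fix x assume x: "x \<in> cball ?p0 r"
    hence "norm (act ?q0 u x - x) \<le> 2 * (1 / 512) * norm (x - ?p0)"
      using r(3)[OF u] by (intro \<rho>(2)[OF u]) (simp add: dist_norm norm_minus_commute)
    also have "\<dots> \<le> 2 * (1 / 512) * r" using x by (simp add: dist_norm norm_minus_commute)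
    finally show "norm (act ?q0 u x - x) \<le> r / 256" by simp
  qed (use r(1) in simp)
  then obtain X where X: "\<And>u. u \<in> ?W \<Longrightarrow> open (X u)" "\<And>u. u \<in> ?W \<Longrightarrow> ?q0 \<in> X u"
    "\<And>u q. u \<in> ?W \<Longrightarrow> q \<in> X u \<Longrightarrow> displacement_le q u ?p0 r (r / 128)"
    by metis
  \<comment> \<open>The conditions on the words concern \<open>(A, B, C)\<close> and are pulled back
    along the projection that forgets \<open>D\<close>.\<close>
  define N3 where "N3 = (\<lambda>x::complex \<times> complex \<times> complex \<times> complex. (fst x, fst (snd x), fst (snd (snd x)))) -`
    (\<Inter>u\<in>?W. X u)"
  have N3: "open N3" "(A0, B0, C0, D0) \<in> N3"
    "\<And>A B C D u. (A, B, C, D) \<in> N3 \<Longrightarrow> u \<in> ?W \<Longrightarrow> displacement_le (A, B, C) u ?p0 r (r / 128)"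
  proof -
    show "open N3"
      unfolding N3_def using X(1) by (intro open_vimage open_INT continuous_intros) auto
    show "(A0, B0, C0, D0) \<in> N3" using X(2) by (simp add: N3_def)
    show "displacement_le (A, B, C) u ?p0 r (r / 128)" if "(A, B, C, D) \<in> N3" "u \<in> ?W" for A B C D u
      using that X(3)[OF that(2)] by (auto simp: N3_def)
  qed
  obtain N4 where N4: "open N4" "(A0, B0, C0, D0) \<in> N4"
    "\<And>A B C D. (A, B, C, D) \<in> N4 \<Longrightarrow> \<exists>z'. norm (z' - z0) < r / 2 \<and> (of_real a, y0, z') \<in> surface A B C D"
    using surface_point_nearby[OF p0(1), of "r / 2"] r(1) by auto
  have "coexistence A B C D" if N: "(A, B, C, D) \<in> N1 \<inter> N2 \<inter> N3 \<inter> N4" for A B C D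
  proof -
    obtain z1 where z1: "norm (z1 - t) < d" "(t, t, z1) \<in> surface A B C D" using N N2(3) by blast
    obtain z2 where z2: "norm (z2 - z0) < r / 2" "(of_real a, y0, z2) \<in> surface A B C D"
      using N N4(3) by blast
    have "dist ?p0 (of_real a, y0, z2) < r / 2"
      using z2(1) by (simp add: dist_norm norm_Pair norm_minus_commute)
    with z2(2) have p2: "(of_real a, y0, z2) \<in> surface A B C D \<inter> ball ?p0 (r / 2)" by simp
    show ?thesis
    proof (rule coexistence_if_near_identity[OF _ _ n(1) w_def v_def r(1) _ _ p2])
      show "separated (T - d) (T + d) (A, B, C)" using N N1(3) by blast
      show "(t, t, z1) \<in> surface A B C D \<inter> shell (T - d) (T + d)" using z1 shell by blast
      show "norm (fst ?p0) + r \<le> 2" using r(2) by simp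
      show "displacement_le (A, B, C) u ?p0 r (r / 128)" if "u \<in> ?W" for u
        using N N3(3) that by blast
    qed
  qed
  thus ?thesis
    using N1(1,2) N2(1,2) N3(1,2) N4(1,2)
    by (intro exI[of _ "N1 \<inter> N2 \<inter> N3 \<inter> N4"]) auto
qed

text \<open>The origin is the common fixed point, and (-3, -3, -3) lies on the surface since 27 - 27
  = 0; the required gap is 9 - 6 > 0.\<close>

lemma coexistence_near_0:
  "\<exists>N. open N \<and> (0, 0, 0, 0) \<in> N \<and> (\<forall>A B C D. (A, B, C, D) \<in> N \<longrightarrow> coexistence A B C D)"
proof (rule coexistence_near[where a = 0 and ?y0.0 = 0 and ?z0.0 = 0 and t = "- 3"])
  show "flip (0, 0, 0) c (of_real 0, 0, 0) = (of_real 0, 0, 0)" for c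
    by (cases c) (auto simp: s_x_def s_y_def s_z_def)
qed (auto simp: surface_def)

text \<open>At these parameters \<open>(a, 2, 2)\<close> is a fixed singular point, and \<open>(t, t, t)\<close> with
  \<open>t = 2 - s\<^sup>2\<close> lies on the surface whenever \<open>a = 2 - 3 s\<^sup>2 + s\<^sup>3\<close>.\<close>

lemma coexistence_near_param:
  assumes a: "a \<in> {-2<..<2::real}"
  shows "\<exists>N. open N \<and> (param_ABC a, param_ABC a, param_ABC a, param_D a) \<in> N \<and>
    (\<forall>A B C D. (A, B, C, D) \<in> N \<longrightarrow> coexistence A B C D)"
proof -
  define g where "g = (\<lambda>s::real. 2 - 3 * s\<^sup>2 + s ^ 3)"
  \<comment> \<open>Since \<open>g 2 = -2\<close> and \<open>g 3 = 2\<close>, the intermediate value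
    theorem applies; \<open>a > -2\<close> then excludes \<open>s = 2\<close>.\<close>
  have "\<exists>s\<ge>2. s \<le> 3 \<and> g s = a"
    using a by (intro IVT') (auto simp: g_def power2_eq_square power3_eq_cube intro!: continuous_intros)
  then obtain s where s: "2 \<le> s" "s \<le> 3" "g s = a" by blast
  have "s \<noteq> 2" using s(3) a by (auto simp: g_def power2_eq_square power3_eq_cube)
  hence s2: "2 < s" using s by simp
  define t where "t = 2 - s\<^sup>2"
  have as: "a = 2 - 3 * s\<^sup>2 + s ^ 3" using s(3) by (simp add: g_def)
  have s4: "4 < s\<^sup>2" using s2 power_strict_mono[of 2 s 2] by simp
  have norm_t: "norm (of_real t :: complex) = s\<^sup>2 - 2" 
    unfolding norm_of_real t_def using s4 by simp
  \<comment> \<open>This product is exactly the difference of the two sides of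
    \<open>gap\<close>.\<close>
  have "0 < s ^ 3 * (s - 2)" using s2 by simp
  hence gap: "2 * a + 4 < (s\<^sup>2 - 2)\<^sup>2 - 2 * (s\<^sup>2 - 2)"
    unfolding as by (simp add: power2_eq_square power3_eq_cube algebra_simps)
  have norm_A: "norm (param_ABC a) = 2 * a + 4"
    using a unfolding param_ABC_def norm_of_real by simp
  show ?thesis
  proof (rule coexistence_near[where a = a and ?y0.0 = 2 and ?z0.0 = 2 and t = "of_real t"])
    show "(of_real a, 2, 2) \<in> surface (param_ABC a) (param_ABC a) (param_ABC a) (param_D a)"
      by (simp add: surface_def param_ABC_def param_D_def power2_eq_square algebra_simps)
    show "\<bar>a\<bar> < 2" using a by auto
    show "flip (param_ABC a, param_ABC a, param_ABC a) c (of_real a, 2, 2) = (of_real a, 2, 2)" for c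
      by (cases c) (auto simp: s_x_def s_y_def s_z_def param_ABC_def)
    have "t\<^sup>2 + t\<^sup>2 + t\<^sup>2 + t * t * t = 3 * ((2 * a + 4) * t) - (a\<^sup>2 + 8 * a + 8)"
      unfolding as t_def by algebra
    hence "complex_of_real (t\<^sup>2 + t\<^sup>2 + t\<^sup>2 + t * t * t) =
        complex_of_real (3 * ((2 * a + 4) * t) - (a\<^sup>2 + 8 * a + 8))" by (rule arg_cong)
    thus "(of_real t, of_real t, of_real t) \<in>
        surface (param_ABC a) (param_ABC a) (param_ABC a) (param_D a)"
      by (simp add: surface_def param_ABC_def param_D_def algebra_simps)
  qed (use norm_t norm_A s4 gap in simp_all)
qed

theorem theoremF:
  shows "\<exists>P :: (complex \<times> complex \<times> complex \<times> complex) set.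
    open P \<and> (0, 0, 0, 0) \<in> P \<and>
    (\<forall>a\<in>{-2<..<2::real}. (param_ABC a, param_ABC a, param_ABC a, param_D a) \<in> P) \<and>
    (\<forall>A B C D. (A, B, C, D) \<in> P \<longrightarrow>
      (\<exists>U V.
        open_in_surface A B C D U \<and> open_in_surface A B C D V \<and>
        U \<noteq> {} \<and> V \<noteq> {} \<and> U \<inter> V = {} \<and>
        locally_nondiscrete_on A B C D U \<and> U \<subseteq> \<N> A B C D \<and>
        (\<forall>p\<in>V. \<forall>W. open_in_surface A B C D W \<and> p \<in> W \<longrightarrow> locally_discrete_on A B C D W) \<and>
        V \<subseteq> \<D> A B C D \<and>
        properly_discontinuous_on A B C D V \<and>
        (\<forall>\<delta>>0. \<exists>\<gamma>\<^sub>1\<in>\<G> A B C D. \<exists>\<gamma>\<^sub>2\<in>\<G> A B C D.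
          \<gamma>\<^sub>1 \<otimes>\<^bsub>BS A B C D\<^esub> \<gamma>\<^sub>2 \<noteq> \<gamma>\<^sub>2 \<otimes>\<^bsub>BS A B C D\<^esub> \<gamma>\<^sub>1 \<and>
          (SUP q\<in>U. ereal (norm (\<gamma>\<^sub>1 q - q))) < ereal \<delta> \<and>
          (SUP q\<in>U. ereal (norm (\<gamma>\<^sub>2 q - q))) < ereal \<delta>)))"
proof -
  \<comment> \<open>The union of all open sets on which coexistence holds serves as the parameter
    set, so it suffices to find a neighbourhood of each prescribed parameter.\<close>
  define F where "F = {N. open N \<and> (\<forall>A B C D. (A, B, C, D) \<in> N \<longrightarrow> coexistence A B C D)}"
  have cover: "q \<in> \<Union>F"
    if "\<exists>N. open N \<and> q \<in> N \<and> (\<forall>A B C D. (A, B, C, D) \<in> N \<longrightarrow> coexistence A B C D)" for q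
  proof -
    from that obtain N where N: "q \<in> N" "open N \<and> (\<forall>A B C D. (A, B, C, D) \<in> N \<longrightarrow> coexistence A B C D)"
      by (elim exE conjE) simp
    have "N \<in> F" unfolding F_def by (rule CollectI) (rule N(2))
    thus ?thesis using N(1) by (rule UnionI)
  qed
  show ?thesis
    unfolding coexistence_def[symmetric]
  proof (intro exI[of _ "\<Union>F"] conjI ballI allI impI)
    show "open (\<Union>F)" by (rule open_Union) (simp add: F_def)
    show "(0, 0, 0, 0) \<in> \<Union>F" by (rule cover[OF coexistence_near_0])
    show "(param_ABC a, param_ABC a, param_ABC a, param_D a) \<in> \<Union>F" if "a \<in> {-2<..<2}" for a
      by (rule cover[OF coexistence_near_param[OF that]])
    show "coexistence A B C D" if q: "(A, B, C, D) \<in> \<Union>F" for A B C D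
    proof -
      obtain N where "N \<in> F" "(A, B, C, D) \<in> N" using q by (rule UnionE)
      thus ?thesis by (simp add: F_def)
    qed
  qed
qed

end
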